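(* Let $k$ be an infinite field, $R=k[x,y]$ the standard graded polynomial ring, and $\mathfrak m=(x,y)$. Let $I,J\subseteq R$ be nonzero homogeneous componentwise linear ideals. Then $I+J$ is componentwise linear if and only if at least one of the following holds: (1) $o(I\cap J)=\max\{o(I),o(J)\}$; (2) $o(I\cap J)=\max\{o(I),o(J)\}+1$ and $(I+J):\mathfrak m\neq (I:\mathfrak m)+(J:\mathfrak m)$.
   Context: For a nonzero homogeneous ideal $I$, $o(I)$ denotes the smallest degree of a nonzero element of $I$. For a homogeneous ideal $I$, $I_{\langle j\rangle}$ denotes the ideal generated by all forms of degree $j$ in $I$. A homogeneous ideal generated in a single degree $d$ has a linear resolution if its Castelnuovo-Mumford regularity is $d$ (the zero ideal is regarded as having a linear resolution). $I$ is componentwise linear if $I_{\langle j\rangle}$ has a linear resolution for all $j\ge 0$. *)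

theory Defs
  imports
    "HOL-Computational_Algebra.Polynomial"
    "HOL-Library.Set_Algebras"
    "Jordan_Normal_Form.Matrix_Kernel"
begin

text \<open>
  The ring \<open>R = k[x,y]\<close> is the type \<^typ>\<open>'k::field poly poly\<close>, read as \<open>k[x][y]\<close>: the
  coefficient of \<open>x\<^sup>i y\<^sup>j\<close> in \<open>f\<close> is \<open>coeff (coeff f j) i\<close>.
  Sums of ideals are sums of sets in the sense of \<^theory>\<open>HOL-Library.Set_Algebras\<close>.
\<close>

definition varX :: "'k::field poly poly"
  where "varX = monom (monom 1 1) 0"

definition varY :: "'k::field poly poly"
  where "varY = monom (monom 1 0) 1"

text \<open>
  Ideals are the submodules of the ring over itself: \<open>rideal.subspace I\<close> says that \<open>I\<close> is an
  ideal, and \<open>rideal.span S\<close> is the ideal generated by \<open>S\<close>.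
\<close>

interpretation rideal: Modules.module "(*) :: 'a::comm_ring_1 \<Rightarrow> 'a \<Rightarrow> 'a"
  by standard (simp_all add: algebra_simps)

definition max_ideal :: "'k::field poly poly set"
  where "max_ideal = rideal.span {varX, varY}"

definition ideal_colon :: "'a::comm_ring_1 set \<Rightarrow> 'a set \<Rightarrow> 'a set"
  where "ideal_colon I A = {f. \<forall>g\<in>A. f * g \<in> I}"


text \<open>A form of degree \<open>d\<close>; the zero polynomial is a form of every degree.\<close>

definition form :: "nat \<Rightarrow> 'k::field poly poly \<Rightarrow> bool"
  where "form d f \<longleftrightarrow> (\<forall>i j. coeff (coeff f j) i \<noteq> 0 \<longrightarrow> i + j = d)"

text \<open>The total degree; meaningful only for \<open>f \<noteq> 0\<close>.\<close>

definition tdeg :: "'k::field poly poly \<Rightarrow> nat"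
  where "tdeg f = Max {i + j |i j. coeff (coeff f j) i \<noteq> 0}"

definition homogeneous_ideal :: "'k::field poly poly set \<Rightarrow> bool"
  where "homogeneous_ideal I \<longleftrightarrow> (\<exists>S. (\<forall>f\<in>S. \<exists>d. form d f) \<and> I = rideal.span S)"

definition init_deg :: "'k::field poly poly set \<Rightarrow> nat"
  where "init_deg I = (LEAST d. \<exists>f\<in>I. f \<noteq> 0 \<and> tdeg f = d)"

definition deg_component :: "'k::field poly poly set \<Rightarrow> nat \<Rightarrow> 'k poly poly set"
  where "deg_component I j = rideal.span {f \<in> I. form j f}"


text \<open>
  A list \<open>[a\<^sub>1, \<dots>, a\<^sub>n]\<close> of degrees stands for the graded free module
  \<open>R(-a\<^sub>1) \<oplus> \<dots> \<oplus> R(-a\<^sub>n)\<close>. A matrix \<open>A\<close> gives a degree-preserving map from the module of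
  \<open>bs\<close> to the module of \<open>as\<close> iff its \<open>(p,q)\<close> entry is a form of degree \<open>b\<^sub>q - a\<^sub>p\<close>,
  which has to be \<open>0\<close> if this number is negative.
\<close>

definition graded_map :: "nat list \<Rightarrow> nat list \<Rightarrow> 'k::field poly poly mat \<Rightarrow> bool"
  where "graded_map as bs A \<longleftrightarrow>
    A \<in> carrier_mat (length as) (length bs) \<and>
    (\<forall>p<length as. \<forall>q<length bs.
       A $$ (p, q) = 0 \<or> (as ! p \<le> bs ! q \<and> form (bs ! q - as ! p) (A $$ (p, q))))"

definition mat_range :: "'a::comm_ring_1 mat \<Rightarrow> 'a vec set"
  where "mat_range A = {A *\<^sub>v v |v. v \<in> carrier_vec (dim_col A)}"

text \<open>
  A minimal graded free resolution
  \<open>\<dots> \<rightarrow> F\<^sub>2 \<rightarrow> F\<^sub>1 \<rightarrow> F\<^sub>0 \<rightarrow> I \<rightarrow> 0\<close> of the ideal \<open>I\<close>. Here \<open>a i\<close> lists the degrees of the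
  basis of \<open>F\<^sub>i\<close>, the matrix \<open>D i\<close> is the map from \<open>F\<^sub>i\<^sub>+\<^sub>1\<close> to \<open>F\<^sub>i\<close>, and the one-row matrix
  \<open>E\<close> is the map from \<open>F\<^sub>0\<close> to \<open>R\<close> (with \<open>R\<close> as the module of the list \<open>[0]\<close>) whose image is
  \<open>I\<close>. Some or all of the \<open>F\<^sub>i\<close> may be zero, that is, \<open>a i = []\<close>. Minimality is the
  condition that \<open>F\<^sub>i\<^sub>+\<^sub>1\<close> is mapped into \<open>\<mm>F\<^sub>i\<close>.
\<close>

definition minimal_graded_free_resolution ::
  "'k::field poly poly set \<Rightarrow> (nat \<Rightarrow> nat list) \<Rightarrow> 'k poly poly mat \<Rightarrow>
   (nat \<Rightarrow> 'k poly poly mat) \<Rightarrow> bool"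
  where "minimal_graded_free_resolution I a E D \<longleftrightarrow>
    graded_map [0] (a 0) E \<and>
    (\<forall>i. graded_map (a i) (a (Suc i)) (D i)) \<and>
    {w $ 0 |w. w \<in> mat_range E} = I \<and>
    mat_range (D 0) = mat_kernel E \<and>
    (\<forall>i. mat_range (D (Suc i)) = mat_kernel (D i)) \<and>
    (\<forall>i. \<forall>p<length (a i). \<forall>q<length (a (Suc i)). D i $$ (p, q) \<in> max_ideal)"

text \<open>
  The Castelnuovo--Mumford regularity is the largest \<open>j - i\<close> such that \<open>R(-j)\<close> is a summand
  of the \<open>i\<close>-th module of the minimal graded free resolution, which is unique up to
  isomorphism. It is given as a relation; no integer is the regularity of the zero ideal.
\<close>

definition has_regularity :: "'k::field poly poly set \<Rightarrow> int \<Rightarrow> bool"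
  where "has_regularity I r \<longleftrightarrow>
    (\<exists>a E D. minimal_graded_free_resolution I a E D \<and>
       (\<exists>i. \<exists>j\<in>set (a i). r = int j - int i) \<and>
       (\<forall>i. \<forall>j\<in>set (a i). int j - int i \<le> r))"

definition linear_resolution :: "'k::field poly poly set \<Rightarrow> bool"
  where "linear_resolution I \<longleftrightarrow>
    I = {0} \<or>
    (\<exists>d. (\<exists>S. (\<forall>f\<in>S. form d f) \<and> I = rideal.span S) \<and> has_regularity I (int d))"

definition componentwise_linear :: "'k::field poly poly set \<Rightarrow> bool"
  where "componentwise_linear I \<longleftrightarrow> (\<forall>j. linear_resolution (deg_component I j))"

end

theory Submission
  imports Defs "Jordan_Normal_Form.Determinant"
begin

text \<open>
  For a nonzero finite-dimensional space \<open>V\<close> of forms of one degree,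
  \<open>dim R\<^sub>1V + dim (V : \<mm>) = 2 dim V\<close> and \<open>dim (V : \<mm>) < dim V\<close>, hence \<open>dim R\<^sub>1V > dim V\<close>. The
  ideal generated by \<open>V\<close> has a linear resolution iff \<open>dim R\<^sub>1V = dim V + 1\<close>, and then \<open>V = h R\<^sub>e\<close> for
  a form \<open>h\<close>. So \<open>I\<close> is componentwise linear iff all components \<open>I\<^sub>n\<close> have this minimal growth.

  If \<open>V, U \<noteq> {0}\<close> have minimal growth, then \<open>(R\<^sub>1V \<inter> R\<^sub>1U) : \<mm> = V \<inter> U\<close>, and counting dimensions
  shows that \<open>V + U\<close> has minimal growth iff \<open>R\<^sub>1V \<inter> R\<^sub>1U \<noteq> {0}\<close>. With \<open>b = max (o(I)) (o(J))\<close>,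
  therefore, \<open>I + J\<close> is componentwise linear iff \<open>R\<^sub>1I\<^sub>b \<inter> R\<^sub>1J\<^sub>b \<noteq> {0}\<close>; this follows from
  \<open>o(I \<inter> J) = b\<close> and implies \<open>o(I \<inter> J) \<le> b + 1\<close>. When \<open>I\<^sub>b \<inter> J\<^sub>b = {0}\<close>, the colon ideals decide
  between the two possibilities: if \<open>I\<^sub>b + J\<^sub>b\<close> has minimal growth, then \<open>((I + J) : \<mm>)\<^sub>b\<^sub>-\<^sub>1\<close>
  is larger by one dimension than \<open>(I : \<mm>)\<^sub>b\<^sub>-\<^sub>1 + (J : \<mm>)\<^sub>b\<^sub>-\<^sub>1\<close>, and if
  \<open>R\<^sub>1I\<^sub>b \<inter> R\<^sub>1J\<^sub>b = {0}\<close>, the two agree.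
\<close>

section \<open>Dimensions of finite-dimensional subspaces\<close>

text \<open>
  A locale of its own: the unqualified interpretation of \<^locale>\<open>vector_space\<close> for real vector
  spaces would shadow every constant defined in \<^locale>\<open>vector_space\<close> itself.
\<close>

locale ambient_space = vector_space
begin

definition fin_dim :: "'b set \<Rightarrow> bool"
  where "fin_dim V \<longleftrightarrow> (\<exists>B. finite B \<and> V \<subseteq> span B)"

lemma fin_dim_subset: "fin_dim V \<Longrightarrow> W \<subseteq> V \<Longrightarrow> fin_dim W"
  unfolding fin_dim_def by blast

lemma independent_in_fin_dim:
  assumes "fin_dim V" "independent C" "C \<subseteq> V"
  shows "finite C"
  using assms independent_span_bound unfolding fin_dim_def by (metis order_trans)

lemma fin_dim_basis:
  assumes "subspace V" "fin_dim V"
  obtains B where "B \<subseteq> V" "independent B" "span B = V" "finite B" "card B = dim V"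
proof -
  obtain B where B: "B \<subseteq> V" "independent B" "V \<subseteq> span B" "card B = dim V"
    using basis_exists by blast
  show thesis
    using that[OF B(1,2) span_subspace[OF B(1,3) assms(1)] _ B(4)]
      independent_in_fin_dim[OF assms(2) B(2,1)] by blast
qed

lemma fin_dim_basis_extend:
  assumes "subspace V" "fin_dim V" "independent C" "C \<subseteq> V"
  obtains B where "C \<subseteq> B" "B \<subseteq> V" "independent B" "span B = V" "finite B" "card B = dim V"
proof -
  obtain B where B: "C \<subseteq> B" "B \<subseteq> V" "independent B" "V \<subseteq> span B"
    using maximal_independent_subset_extend assms(3,4) by blast
  show thesis
    using that[OF B(1-3) span_subspace[OF B(2,4) assms(1)]]
      independent_in_fin_dim[OF assms(2) B(3,2)] basis_card_eq_dim[OF B(2,4,3)] by blast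
qed

lemma fin_dim_dim_mono:
  assumes "subspace V" "subspace W" "fin_dim V" "W \<subseteq> V"
  shows "dim W \<le> dim V"
proof -
  obtain C where C: "C \<subseteq> W" "independent C" "span C = W" "finite C" "card C = dim W"
    using fin_dim_basis assms fin_dim_subset by metis
  obtain B where "C \<subseteq> B" "finite B" "card B = dim V"
    using fin_dim_basis_extend[OF assms(1,3) C(2) order_trans[OF C(1) assms(4)]] by metis
  with C show ?thesis by (metis card_mono)
qed

lemma fin_dim_eqI:
  assumes "subspace V" "subspace W" "fin_dim V" "W \<subseteq> V" "dim V \<le> dim W"
  shows "W = V"
proof -
  obtain C where C: "C \<subseteq> W" "independent C" "span C = W" "finite C" "card C = dim W"
    using fin_dim_basis assms fin_dim_subset by metis
  obtain B where B: "C \<subseteq> B" "finite B" "card B = dim V" "span B = V"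
    using fin_dim_basis_extend[OF assms(1,3) C(2) order_trans[OF C(1) assms(4)]] by metis
  have "C = B" using B C assms(5) by (intro card_seteq) auto
  with B C show ?thesis by simp
qed

lemma dim_zero_subspace [simp]: "dim {0} = 0"
  using dim_le_card[of "{0}" "{}"] by simp

lemma subspace_set_plus: "subspace S \<Longrightarrow> subspace T \<Longrightarrow> subspace (S + T)"
  using subspace_sums[of S T]
  by (rule back_subst[of subspace]) (auto simp: set_plus_def)

lemma set_plus_superset:
  assumes "subspace S" "subspace T"
  shows "S \<subseteq> S + T" "T \<subseteq> S + T"
proof -
  have "x \<in> S + T" if "x \<in> S" for x
    using set_plus_intro[OF that subspace_0[OF assms(2)]] by simp
  then show "S \<subseteq> S + T" ..
  have "x \<in> S + T" if "x \<in> T" for x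
    using set_plus_intro[OF subspace_0[OF assms(1)] that] by simp
  then show "T \<subseteq> S + T" ..
qed

lemma set_plus_subset:
  assumes "subspace U" "S \<subseteq> U" "T \<subseteq> U"
  shows "S + T \<subseteq> U"
  using assms by (auto simp: set_plus_def intro!: subspace_add)

lemma fin_dim_set_plus:
  assumes "fin_dim S" "fin_dim T"
  shows "fin_dim (S + T)"
proof -
  obtain B C where BC: "finite B" "S \<subseteq> span B" "finite C" "T \<subseteq> span C"
    using assms unfolding fin_dim_def by blast
  have "S + T \<subseteq> span (B \<union> C)"
    using BC span_mono[of B "B \<union> C"] span_mono[of C "B \<union> C"]
    by (intro set_plus_subset) auto
  with BC show ?thesis unfolding fin_dim_def by blast
qed

text \<open>Grassmann's formula. A basis \<open>B\<close> of \<open>S \<inter> T\<close> is extended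
  to a basis \<open>D\<close> of \<open>T\<close>; the added vectors \<open>E\<close>, together with
  any basis \<open>C\<close> of \<open>S\<close>, form a basis of \<open>S + T\<close>.\<close>

lemma dim_set_plus_Int:
  assumes S: "subspace S" "fin_dim S" and T: "subspace T" "fin_dim T"
  shows "dim (S + T) + dim (S \<inter> T) = dim S + dim T"
proof -
  obtain C where C: "C \<subseteq> S" "independent C" "span C = S" "finite C" "card C = dim S"
    using fin_dim_basis S by metis
  have ST: "subspace (S \<inter> T)" "fin_dim (S \<inter> T)"
    using S T by (auto intro: subspace_inter fin_dim_subset[OF S(2)])
  then obtain B where B: "B \<subseteq> S \<inter> T" "independent B" "span B = S \<inter> T" "finite B"
      "card B = dim (S \<inter> T)"
    using fin_dim_basis by metis
  obtain D where D: "B \<subseteq> D" "D \<subseteq> T" "independent D" "span D = T" "finite D" "card D = dim T"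
    using fin_dim_basis_extend[OF T B(2)] B(1) by (metis inf.boundedE)
  define E where "E = D - B"
  have E: "finite E" "D = B \<union> E" "B \<inter> E = {}" "card D = card B + card E"
    using D(1,5) B(4) card_mono[OF D(5,1)] by (auto simp: E_def card_Diff_subset finite_subset)
  \<comment> \<open>\<open>E\<close> is independent modulo \<open>S\<close>: a combination of
    \<open>E\<close> that lies in \<open>S\<close> also lies in \<open>T\<close>, hence in
    \<open>span B\<close>, and \<open>D = B \<union> E\<close> is independent.\<close>
  have zero: "f x = 0" if "(\<Sum>x\<in>E. scale (f x) x) \<in> S" "x \<in> E" for f x
  proof -
    have "(\<Sum>x\<in>E. scale (f x) x) \<in> T"
      by (rule subspace_sum[OF T(1)]) (use D E T in \<open>auto intro!: subspace_scale\<close>)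
    then have "(\<Sum>x\<in>E. scale (f x) x) \<in> span B" using that B by auto
    then obtain g where g: "(\<Sum>x\<in>E. scale (f x) x) = (\<Sum>x\<in>B. scale (g x) x)"
      using span_finite[OF B(4)] by auto
    define h where "h x = (if x \<in> E then f x else - g x)" for x
    have "(\<Sum>x\<in>D. scale (h x) x) = (\<Sum>x\<in>B. scale (h x) x) + (\<Sum>x\<in>E. scale (h x) x)"
      using E B by (simp add: sum.union_disjoint)
    also have "(\<Sum>x\<in>B. scale (h x) x) = - (\<Sum>x\<in>B. scale (g x) x)"
      unfolding sum_negf[symmetric] by (rule sum.cong) (use E in \<open>auto simp: h_def\<close>)
    also have "(\<Sum>x\<in>E. scale (h x) x) = (\<Sum>x\<in>E. scale (f x) x)"
      by (simp add: h_def)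
    finally have "(\<Sum>x\<in>D. scale (h x) x) = 0" using g by simp
    then have "h x = 0"
      using independentD[OF D(3) D(5), of h x] that E by auto
    then show ?thesis using that by (simp add: h_def)
  qed
  have disj: "C \<inter> E = {}"
  proof (rule ccontr)
    assume "C \<inter> E \<noteq> {}"
    then obtain x where x: "x \<in> C" "x \<in> E" by blast
    have "(\<Sum>y\<in>E. scale (if y = x then 1 else 0) y) = x"
      using x E by (simp add: if_distrib[where f = "\<lambda>a. scale a _"] cong: if_cong)
    then show False using zero[of "\<lambda>y. if y = x then 1 else 0" x] x C by auto
  qed
  have indep: "independent (C \<union> E)"
  proof (rule independent_if_scalars_zero)
    show "finite (C \<union> E)" using C E by simp
    fix f x assume f: "(\<Sum>x\<in>C \<union> E. scale (f x) x) = 0" and x: "x \<in> C \<union> E"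
    have f': "(\<Sum>x\<in>C. scale (f x) x) + (\<Sum>x\<in>E. scale (f x) x) = 0"
      using f disj C E by (simp add: sum.union_disjoint)
    then have "(\<Sum>x\<in>E. scale (f x) x) = - (\<Sum>x\<in>C. scale (f x) x)"
      by (simp add: add_eq_0_iff)
    also have "\<dots> \<in> S"
      by (rule subspace_neg[OF S(1)], rule subspace_sum[OF S(1)])
        (use C S in \<open>auto intro!: subspace_scale\<close>)
    finally have zE: "\<forall>x\<in>E. f x = 0" using zero by blast
    with f' have "(\<Sum>x\<in>C. scale (f x) x) = 0" by simp
    then have "\<forall>x\<in>C. f x = 0" using independentD[OF C(2) C(4)] by blast
    with zE x show "f x = 0" by blast
  qed
  have "S + T = span (C \<union> E)"
  proof
    have "B \<subseteq> span (C \<union> E)"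
      using B C span_mono[of C "C \<union> E"] by auto
    then have "span D \<subseteq> span (C \<union> E)"
      using E span_superset[of "C \<union> E"] by (intro span_minimal) auto
    then show "S + T \<subseteq> span (C \<union> E)"
      using C D span_mono[of C "C \<union> E"] by (intro set_plus_subset) auto
    show "span (C \<union> E) \<subseteq> S + T"
      using C D E S T set_plus_superset[OF S(1) T(1)] subspace_set_plus
      by (intro span_minimal) auto
  qed
  then have "dim (S + T) = card C + card E"
    using disj C(4) E(1) by (simp add: dim_eq_card_independent[OF indep] card_Un_disjoint)
  then show ?thesis using B C D E by simp
qed

end

section \<open>Spaces of minimal growth\<close>

text \<open>The module law orients associativity against \<open>mult.assoc\<close>, so the simplifier would loop.\<close>

declare rideal.scale_scale [simp del]

section \<open>The polynomial ring as a vector space over \<open>k\<close>\<close>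

definition scalar :: "'k::field \<Rightarrow> 'k poly poly"
  where "scalar c = [:[:c:]:]"

lemma scalar_simps [simp]: "scalar 0 = 0" "scalar 1 = 1" "scalar a = 0 \<longleftrightarrow> a = 0"
  by (simp_all add: scalar_def flip: one_pCons)

lemma scalar_hom: "scalar (a + b) = scalar a + scalar b" "scalar (a * b) = scalar a * scalar b"
  by (simp_all add: scalar_def flip: one_pCons)

interpretation kv: ambient_space "\<lambda>c f. scalar c * f"
  by unfold_locales (simp_all only: scalar_simps scalar_hom distrib_left distrib_right mult.assoc mult_1)

declare kv.scale_scale [simp del]

lemma varX_mult: "varX * f = Polynomial.smult [:0, 1:] f"
  by (simp add: varX_def monom_altdef)

lemma varY_mult: "varY * f = pCons 0 f"
  by (simp add: varY_def monom_altdef flip: one_pCons)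

lemma varX_neq_0 [simp]: "varX \<noteq> 0" and varY_neq_0 [simp]: "varY \<noteq> 0"
  by (simp_all add: varX_def varY_def)

text \<open>Comparing the coefficients of the zeroth power of \<open>varY\<close> shows that
  \<open>varY\<close> divides \<open>u\<close>. This is the exactness of the Koszul complex of the
  two variables in the middle.\<close>

lemma varX_mult_eq_varY_multE:
  assumes "varX * u = varY * v"
  obtains w where "u = varY * w" "v = varX * w"
proof -
  obtain a w where w: "u = pCons a w" by (cases u)
  have "[:0, 1:] * a = 0"
    using arg_cong[OF assms, of "\<lambda>f. coeff f 0"] unfolding varX_mult varY_mult w by simp
  then have u: "u = varY * w" using w by (simp add: varY_mult)
  have "varY * (varX * w) = varY * v"
    unfolding assms[symmetric] u by (simp only: mult.left_commute)
  then show thesis using that u by simp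
qed

lemma kv_linear_mult:
  "Vector_Spaces.linear (\<lambda>c f. scalar c * f) (\<lambda>c f. scalar c * f) ((*) a)"
  unfolding Vector_Spaces.linear_iff
  by (simp add: kv.vector_space_axioms distrib_left mult.left_commute)

lemma kv_subspace_mult: "kv.subspace V \<Longrightarrow> kv.subspace ((*) a ` V)"
  using module_hom.subspace_image kv_linear_mult module_hom_iff_linear by blast

lemma kv_span_mult: "kv.span ((*) a ` S) = (*) a ` kv.span S"
  using module_hom.span_image kv_linear_mult module_hom_iff_linear by blast

lemma kv_independent_mult: "a \<noteq> 0 \<Longrightarrow> kv.independent B \<Longrightarrow> kv.independent ((*) a ` B)"
  using module_hom.independent_injective_image[of _ _ "(*) a" B] kv_linear_mult module_hom_iff_linear
  by (metis inj_onI mult_left_cancel)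

lemma kv_fin_dim_mult_iff: "a \<noteq> 0 \<Longrightarrow> kv.fin_dim ((*) a ` V) \<longleftrightarrow> kv.fin_dim V"
proof
  assume a: "a \<noteq> 0" and fd: "kv.fin_dim ((*) a ` V)"
  obtain B where B: "B \<subseteq> V" "kv.independent B" "V \<subseteq> kv.span B"
    using kv.maximal_independent_subset by blast
  have "finite ((*) a ` B)"
    using kv.independent_in_fin_dim[OF fd kv_independent_mult[OF a B(2)]] B(1) by blast
  then have "finite B" using a by (simp add: finite_image_iff inj_on_def)
  then show "kv.fin_dim V" using B unfolding kv.fin_dim_def by blast
next
  assume "kv.fin_dim V"
  then obtain B where B: "finite B" "V \<subseteq> kv.span B" unfolding kv.fin_dim_def by blast
  have "(*) a ` V \<subseteq> kv.span ((*) a ` B)" using B by (auto simp: kv_span_mult)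
  then show "kv.fin_dim ((*) a ` V)" using B unfolding kv.fin_dim_def by blast
qed

lemma kv_dim_mult:
  assumes "kv.subspace V" "kv.fin_dim V" "a \<noteq> 0"
  shows "kv.dim ((*) a ` V) = kv.dim V"
proof -
  obtain B where B: "kv.independent B" "kv.span B = V" "finite B" "card B = kv.dim V"
    using kv.fin_dim_basis assms by metis
  have "kv.dim ((*) a ` V) = card ((*) a ` B)"
    using kv.dim_span_eq_card_independent[OF kv_independent_mult[OF assms(3) B(1)]] B(2)
    by (simp add: kv_span_mult)
  also have "\<dots> = card B" using assms(3) by (simp add: card_image inj_on_def)
  finally show ?thesis using B by simp
qed

section \<open>Multiplication and division by the two variables\<close>

text \<open>For a space \<open>V\<close> of forms of degree \<open>n\<close>, these are \<open>R\<^sub>1V\<close> and \<open>(V : \<mm>)\<^sub>n\<^sub>-\<^sub>1\<close>.\<close>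

definition mult_vars :: "'k::field poly poly set \<Rightarrow> 'k poly poly set"
  where "mult_vars V = (*) varX ` V + (*) varY ` V"

definition quot_vars :: "'k::field poly poly set \<Rightarrow> 'k poly poly set"
  where "quot_vars V = {w. varX * w \<in> V \<and> varY * w \<in> V}"

lemma mult_varsE:
  assumes "f \<in> mult_vars V"
  obtains u v where "u \<in> V" "v \<in> V" "f = varX * u + varY * v"
  using assms unfolding mult_vars_def set_plus_def by blast

lemma mult_varsI: "u \<in> V \<Longrightarrow> v \<in> V \<Longrightarrow> varX * u + varY * v \<in> mult_vars V"
  unfolding mult_vars_def by (intro set_plus_intro) auto

lemma mult_vars_mem:
  assumes "kv.subspace V" "u \<in> V"
  shows "varX * u \<in> mult_vars V" "varY * u \<in> mult_vars V"
  using mult_varsI[OF assms(2) kv.subspace_0[OF assms(1)]]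
    mult_varsI[OF kv.subspace_0[OF assms(1)] assms(2)] by simp_all

lemma subspace_mult_vars: "kv.subspace V \<Longrightarrow> kv.subspace (mult_vars V)"
  unfolding mult_vars_def by (intro kv.subspace_set_plus kv_subspace_mult)

lemma fin_dim_mult_vars: "kv.fin_dim V \<Longrightarrow> kv.fin_dim (mult_vars V)"
  unfolding mult_vars_def by (intro kv.fin_dim_set_plus) (simp_all add: kv_fin_dim_mult_iff)

lemma subspace_quot_vars: "kv.subspace V \<Longrightarrow> kv.subspace (quot_vars V)"
  unfolding quot_vars_def kv.subspace_def
  by (auto simp: distrib_left mult.left_commute[of _ "scalar _"])

lemma fin_dim_quot_vars: "kv.fin_dim V \<Longrightarrow> kv.fin_dim (quot_vars V)"
  using kv.fin_dim_subset[of V "(*) varY ` quot_vars V"] kv_fin_dim_mult_iff[of varY]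
  by (auto simp: quot_vars_def)

lemmas vars_intros = subspace_mult_vars fin_dim_mult_vars subspace_quot_vars fin_dim_quot_vars

lemma mult_vars_zero [simp]: "mult_vars {0} = {0}"
  by (simp add: mult_vars_def set_plus_def)

lemma quot_vars_zero [simp]: "quot_vars {0} = {0}"
  by (auto simp: quot_vars_def)

lemma mult_vars_eq_zero_iff:
  assumes "kv.subspace V"
  shows "mult_vars V = {0} \<longleftrightarrow> V = {0}"
  using mult_vars_mem(1)[OF assms] kv.subspace_0[OF assms] by fastforce

lemma subset_quot_mult_vars: "kv.subspace V \<Longrightarrow> V \<subseteq> quot_vars (mult_vars V)"
  by (auto simp: quot_vars_def mult_vars_mem)

lemma mult_quot_vars_subset: "kv.subspace V \<Longrightarrow> mult_vars (quot_vars V) \<subseteq> V"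
  by (auto simp: quot_vars_def intro: kv.subspace_add elim!: mult_varsE)

lemma quot_vars_Int: "quot_vars (V \<inter> U) = quot_vars V \<inter> quot_vars U"
  by (auto simp: quot_vars_def)

lemma quot_vars_mono: "V \<subseteq> U \<Longrightarrow> quot_vars V \<subseteq> quot_vars U"
  by (auto simp: quot_vars_def)

lemma mult_vars_plus: "mult_vars (V + U) = mult_vars V + mult_vars U"
proof -
  have "(*) a ` (V + U) = (*) a ` V + (*) a ` U" for a :: "'a poly poly"
    by (fastforce simp: set_plus_image image_iff distrib_left)
  then show ?thesis unfolding mult_vars_def by (simp add: add.assoc add.left_commute)
qed

text \<open>Grassmann's formula for the two summands of \<open>mult_vars V\<close>: as the variables
  are coprime, the intersection is \<open>varX * varY\<close> times \<open>quot_vars V\<close> and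
  has the same dimension as \<open>quot_vars V\<close>.\<close>

lemma dim_mult_vars_quot_vars:
  assumes V: "kv.subspace V" "kv.fin_dim V"
  shows "kv.dim (mult_vars V) + kv.dim (quot_vars V) = 2 * kv.dim V"
proof -
  have "(*) varX ` V \<inter> (*) varY ` V = (*) (varX * varY) ` quot_vars V"
  proof
    show "(*) varX ` V \<inter> (*) varY ` V \<subseteq> (*) (varX * varY) ` quot_vars V"
    proof
      fix f assume "f \<in> (*) varX ` V \<inter> (*) varY ` V"
      then obtain u v where uv: "u \<in> V" "v \<in> V" "f = varX * u" "varX * u = varY * v" by auto
      then obtain w where w: "u = varY * w" "v = varX * w" using varX_mult_eq_varY_multE by metis
      with uv have "w \<in> quot_vars V" by (simp add: quot_vars_def)
      moreover have "f = varX * varY * w" using uv w by simp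
      ultimately show "f \<in> (*) (varX * varY) ` quot_vars V" by blast
    qed
    have "varX * varY * w = varY * (varX * w)" for w by (simp add: ac_simps)
    then show "(*) (varX * varY) ` quot_vars V \<subseteq> (*) varX ` V \<inter> (*) varY ` V"
      by (auto simp: quot_vars_def mult.assoc)
  qed
  then have "kv.dim (quot_vars V) = kv.dim ((*) varX ` V \<inter> (*) varY ` V)"
    using kv_dim_mult[OF subspace_quot_vars[OF V(1)] fin_dim_quot_vars[OF V(2)], of "varX * varY"]
    by simp
  then show ?thesis
    using kv.dim_set_plus_Int[of "(*) varX ` V" "(*) varY ` V"] V
    by (simp add: mult_vars_def kv_subspace_mult kv_fin_dim_mult_iff kv_dim_mult)
qed

text \<open>Multiplication by \<open>varY\<close> embeds \<open>quot_vars V\<close> into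
  \<open>V\<close>, so only the equality of dimensions has to be excluded.\<close>

lemma dim_quot_vars_less:
  assumes V: "kv.subspace V" "kv.fin_dim V" and "V \<noteq> {0}"
  shows "kv.dim (quot_vars V) < kv.dim V"
proof (rule ccontr)
  assume "\<not> ?thesis"
  moreover have sub: "(*) varY ` quot_vars V \<subseteq> V" by (auto simp: quot_vars_def)
  ultimately have eq: "(*) varY ` quot_vars V = V"
    using V by (intro kv.fin_dim_eqI) (simp_all add: kv_subspace_mult kv_dim_mult vars_intros)
  \<comment> \<open>Every \<open>v \<in> V\<close> is \<open>y w\<close> with \<open>x w \<in> V\<close>, and \<open>x w\<close> has smaller degree in \<open>y\<close>.\<close>
  obtain v where v: "v \<in> V - {0}" "\<And>w. w \<in> V - {0} \<Longrightarrow> degree v \<le> degree w"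
    using assms(3) kv.subspace_0[OF V(1)] arg_min_natI[of "\<lambda>v. v \<in> V - {0}"]
      arg_min_nat_le[of "\<lambda>v. v \<in> V - {0}" _ degree]
    by (metis (no_types, lifting) Diff_iff insert_iff equalityI subsetI empty_iff)
  obtain w where w: "w \<in> quot_vars V" "v = varY * w" using eq v(1) by blast
  with v(1) have "varX * w \<in> V - {0}" by (auto simp: quot_vars_def)
  from v(2)[OF this] w(2) v(1) show False by (auto simp: varX_mult varY_mult)
qed

lemma dim_mult_vars_greater:
  assumes "kv.subspace V" "kv.fin_dim V" "V \<noteq> {0}"
  shows "kv.dim V < kv.dim (mult_vars V)"
  using dim_mult_vars_quot_vars[OF assms(1,2)] dim_quot_vars_less[OF assms] by simp

text \<open>
  Equality holds for \<open>V \<noteq> {0}\<close>. For spaces \<open>V\<close> of forms of one degree the condition says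
  \<open>V = h R\<^sub>e\<close> or \<open>V = {0}\<close>, which is how it detects linear resolutions.
\<close>

definition minimal_growth :: "'k::field poly poly set \<Rightarrow> bool"
  where "minimal_growth V \<longleftrightarrow> kv.subspace V \<and> kv.fin_dim V \<and> kv.dim (mult_vars V) \<le> kv.dim V + 1"

lemma minimal_growthD:
  assumes "minimal_growth V"
  shows "kv.subspace V" "kv.fin_dim V" "kv.dim V \<le> kv.dim (quot_vars V) + 1"
    "V \<noteq> {0} \<Longrightarrow> kv.dim (mult_vars V) = kv.dim V + 1"
    "V \<noteq> {0} \<Longrightarrow> kv.dim (quot_vars V) + 1 = kv.dim V"
  using assms dim_mult_vars_quot_vars[of V] dim_mult_vars_greater[of V]
  unfolding minimal_growth_def by auto

text \<open>The dimensions of \<open>mult_vars V\<close> and \<open>quot_vars V\<close> add up to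
  twice that of \<open>V\<close>, so an upper bound for the first is a lower bound for the
  second.\<close>

lemma minimal_growth_quot_vars_iff:
  assumes "kv.subspace V" "kv.fin_dim V"
  shows "minimal_growth V \<longleftrightarrow> kv.dim V \<le> kv.dim (quot_vars V) + 1"
  using assms dim_mult_vars_quot_vars[of V] unfolding minimal_growth_def by auto

lemma minimal_growth_zero [simp]: "minimal_growth {0}"
  unfolding minimal_growth_def kv.fin_dim_def by auto

text \<open>The dimension of \<open>quot_vars (mult_vars V)\<close> is less than that of
  \<open>mult_vars V\<close>, which is \<open>dim V + 1\<close>; the space contains
  \<open>V\<close>, so it equals \<open>V\<close>.\<close>

lemma quot_mult_vars:
  assumes "minimal_growth V"
  shows "quot_vars (mult_vars V) = V"
proof (cases "V = {0}")
  case False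
  note V = minimal_growthD[OF assms]
  have "kv.dim (quot_vars (mult_vars V)) < kv.dim (mult_vars V)"
    using V False by (intro dim_quot_vars_less) (simp_all add: vars_intros mult_vars_eq_zero_iff)
  then have "V = quot_vars (mult_vars V)"
    using V False by (intro kv.fin_dim_eqI subset_quot_mult_vars) (simp_all add: vars_intros)
  then show ?thesis by simp
qed simp

text \<open>Let \<open>?T\<close> be the intersection on the right. Grassmann's formula turns the
  growth condition for \<open>V + U\<close> into \<open>dim (V \<inter> U) < dim ?T\<close>. As
  \<open>quot_vars ?T = V \<inter> U\<close>, this holds exactly if \<open>?T\<close> is
  nonzero.\<close>

lemma minimal_growth_plus_iff:
  assumes V: "minimal_growth V" "V \<noteq> {0}" and U: "minimal_growth U" "U \<noteq> {0}"
  shows "minimal_growth (V + U) \<longleftrightarrow> mult_vars V \<inter> mult_vars U \<noteq> {0}"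
proof -
  note V' = minimal_growthD[OF V(1)] and U' = minimal_growthD[OF U(1)]
  let ?T = "mult_vars V \<inter> mult_vars U"
  have T: "kv.subspace ?T" "kv.fin_dim ?T"
    using V' U' by (auto intro: kv.subspace_inter vars_intros kv.fin_dim_subset[of "mult_vars V"])
  have quot: "quot_vars ?T = V \<inter> U"
    using V U by (simp add: quot_vars_Int quot_mult_vars)
  have "kv.dim (mult_vars (V + U)) + kv.dim ?T = kv.dim (mult_vars V) + kv.dim (mult_vars U)"
    unfolding mult_vars_plus using V' U' by (intro kv.dim_set_plus_Int) (simp_all add: vars_intros)
  moreover have "kv.dim (V + U) + kv.dim (V \<inter> U) = kv.dim V + kv.dim U"
    using V' U' by (intro kv.dim_set_plus_Int)
  moreover have "kv.subspace (V + U)" "kv.fin_dim (V + U)"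
    using V' U' by (simp_all add: kv.subspace_set_plus kv.fin_dim_set_plus)
  ultimately have "minimal_growth (V + U) \<longleftrightarrow> kv.dim (quot_vars ?T) < kv.dim ?T"
    unfolding minimal_growth_def using V'(4)[OF V(2)] U'(4)[OF U(2)] quot by auto
  then show ?thesis using dim_quot_vars_less[OF T] by auto
qed

text \<open>Let \<open>x p = u + v\<close> and \<open>y p = u' + v'\<close>. The identity
  \<open>y (x p) = x (y p)\<close> equates an element of \<open>mult_vars V\<close> with one of
  \<open>mult_vars U\<close>, so both vanish. Hence \<open>u = x a\<close>, \<open>u' = y a\<close>,
  \<open>v = x b\<close>, \<open>v' = y b\<close>, and \<open>p = a + b\<close>.\<close>

lemma quot_vars_plus_direct:
  assumes V: "kv.subspace V" and U: "kv.subspace U" and zero: "mult_vars V \<inter> mult_vars U = {0}"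
  shows "quot_vars (V + U) \<subseteq> quot_vars V + quot_vars U"
proof
  fix p assume "p \<in> quot_vars (V + U)"
  then obtain u v u' v' where uv: "u \<in> V" "v \<in> U" "varX * p = u + v"
      "u' \<in> V" "v' \<in> U" "varY * p = u' + v'"
    unfolding quot_vars_def set_plus_def by auto
  have "varY * (varX * p) = varX * (varY * p)" by (simp add: algebra_simps)
  then have eq: "varX * (- u') + varY * u = varX * v' + varY * (- v)"
    unfolding uv by (simp add: algebra_simps)
  moreover have "varX * (- u') + varY * u \<in> mult_vars V" "varX * v' + varY * (- v) \<in> mult_vars U"
    using uv V U by (blast intro: mult_varsI kv.subspace_neg)+
  ultimately have "varX * (- u') + varY * u \<in> {0}" "varX * v' + varY * (- v) \<in> {0}"
    using zero by (metis IntI)+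
  then have 0: "varX * u' = varY * u" "varX * v' = varY * v" by (simp_all add: algebra_simps)
  obtain a where a: "u' = varY * a" "u = varX * a"
    using varX_mult_eq_varY_multE[OF 0(1)] .
  obtain b where b: "v' = varY * b" "v = varX * b"
    using varX_mult_eq_varY_multE[OF 0(2)] .
  have "varX * p = varX * (a + b)" using uv a b by (simp add: algebra_simps)
  then have "p = a + b" by simp
  then show "p \<in> quot_vars V + quot_vars U"
    using a b uv by (auto simp: quot_vars_def intro!: set_plus_intro)
qed

lemma quot_vars_plus_supset:
  assumes "kv.subspace V" "kv.subspace U"
  shows "quot_vars V + quot_vars U \<subseteq> quot_vars (V + U)"
  using assms
  by (intro kv.set_plus_subset vars_intros kv.subspace_set_plus quot_vars_mono kv.set_plus_superset)

text \<open>The sum on the right has dimension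
  \<open>dim V + dim U - 2 - dim (quot_vars (V \<inter> U))\<close>. As \<open>V \<inter> U\<close>
  is nonzero, this is at least \<open>dim (V + U) - 1\<close>, hence at least the dimension of the
  left side.\<close>

lemma quot_vars_plus_Int_nonzero:
  assumes V: "minimal_growth V" and U: "minimal_growth U" and Int: "V \<inter> U \<noteq> {0}"
  shows "quot_vars (V + U) = quot_vars V + quot_vars U"
proof -
  note V' = minimal_growthD[OF V] and U' = minimal_growthD[OF U]
  have Int': "kv.subspace (V \<inter> U)" "kv.fin_dim (V \<inter> U)" "kv.subspace (V + U)" "kv.fin_dim (V + U)"
    using V' U' by (auto intro: kv.subspace_inter kv.fin_dim_subset[of V] kv.subspace_set_plus
        kv.fin_dim_set_plus)
  have nz: "V \<noteq> {0}" "U \<noteq> {0}"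
    using Int kv.subspace_0[OF V'(1)] kv.subspace_0[OF U'(1)] by auto
  have "kv.dim (quot_vars V + quot_vars U) + kv.dim (quot_vars (V \<inter> U)) =
      kv.dim (quot_vars V) + kv.dim (quot_vars U)"
    unfolding quot_vars_Int using V' U' by (intro kv.dim_set_plus_Int) (simp_all add: vars_intros)
  moreover have "kv.dim (quot_vars (V \<inter> U)) < kv.dim (V \<inter> U)"
    using Int' Int by (intro dim_quot_vars_less)
  moreover have "kv.dim (V + U) + kv.dim (V \<inter> U) = kv.dim V + kv.dim U"
    using V' U' by (intro kv.dim_set_plus_Int)
  moreover have "kv.dim (quot_vars (V + U)) < kv.dim (V + U)"
    using Int' nz kv.set_plus_superset[OF V'(1) U'(1)] kv.subspace_0[OF V'(1)]
    by (intro dim_quot_vars_less) auto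
  ultimately have "kv.dim (quot_vars (V + U)) \<le> kv.dim (quot_vars V + quot_vars U)"
    using V'(5) U'(5) nz by linarith
  then show ?thesis
    using Int' V' U' quot_vars_plus_supset[OF V'(1) U'(1)]
    by (intro kv.fin_dim_eqI[symmetric])
       (simp_all add: vars_intros kv.subspace_set_plus kv.fin_dim_set_plus)
qed

text \<open>The right side has dimension at most \<open>dim V + dim U - 2 = dim (V + U) - 2\<close>,
  while minimal growth gives the left side at least \<open>dim (V + U) - 1\<close>.\<close>

lemma quot_vars_plus_Int_zero:
  assumes V: "minimal_growth V" "V \<noteq> {0}" and U: "minimal_growth U" "U \<noteq> {0}"
    and Int: "V \<inter> U = {0}" and VU: "minimal_growth (V + U)"
  shows "\<not> quot_vars (V + U) \<subseteq> quot_vars V + quot_vars U"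
proof
  note V' = minimal_growthD[OF V(1)] and U' = minimal_growthD[OF U(1)]
    and VU' = minimal_growthD[OF VU]
  assume "quot_vars (V + U) \<subseteq> quot_vars V + quot_vars U"
  then have "kv.dim (quot_vars (V + U)) \<le> kv.dim (quot_vars V + quot_vars U)"
    using V' U' VU' by (intro kv.fin_dim_dim_mono)
      (simp_all add: vars_intros kv.subspace_set_plus kv.fin_dim_set_plus)
  moreover have "kv.dim (quot_vars V + quot_vars U) + kv.dim (quot_vars V \<inter> quot_vars U) =
      kv.dim (quot_vars V) + kv.dim (quot_vars U)"
    using V' U' by (intro kv.dim_set_plus_Int) (simp_all add: vars_intros)
  moreover have "kv.dim (V + U) + kv.dim (V \<inter> U) = kv.dim V + kv.dim U"
    using V' U' by (intro kv.dim_set_plus_Int)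
  ultimately show False using V'(5)[OF V(2)] U'(5)[OF U(2)] VU'(3) Int by simp
qed

section \<open>The structure of spaces of minimal growth\<close>

lemma mult_vars_span: "mult_vars (kv.span S) = kv.span ((*) varX ` S \<union> (*) varY ` S)"
  by (auto simp: mult_vars_def kv.span_Un kv_span_mult set_plus_def)

text \<open>Induction on the dimension. \<open>quot_vars V\<close> has one dimension less. If it is
  nonzero, multiplying it by the variables raises its dimension and stays inside \<open>V\<close>,
  so it gives back \<open>V\<close>; thus \<open>quot_vars V\<close> again has minimal growth. If it
  is zero, \<open>V\<close> is a line spanned by \<open>h\<close>.\<close>

lemma minimal_growth_structure:
  assumes "minimal_growth V" "V \<noteq> {0}"
  obtains h e where "h \<noteq> 0" "V = kv.span {h * varX ^ (e - i) * varY ^ i |i. i \<le> e}"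
proof -
  have "\<exists>h e. h \<noteq> 0 \<and> V = kv.span {h * varX ^ (e - i) * varY ^ i |i. i \<le> e}"
    using assms
  proof (induction "kv.dim V" arbitrary: V rule: less_induct)
    case less
    note V = minimal_growthD[OF less.prems(1)]
    let ?W = "quot_vars V"
    have W: "kv.subspace ?W" "kv.fin_dim ?W" using V by (simp_all add: vars_intros)
    show ?case
    proof (cases "?W = {0}")
      case True
      with V less.prems have "kv.dim V = 1" by simp
      then obtain B where B: "kv.span B = V" "card B = 1"
        using kv.fin_dim_basis[OF V(1,2)] by metis
      then obtain h where "B = {h}" using card_1_singletonE by metis
      with B less.prems have "h \<noteq> 0" "V = kv.span {h * varX ^ (0 - i) * varY ^ i |i. i \<le> 0}"
        by (auto simp: kv.span_insert_0)
      then show ?thesis by blast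
    next
      case False
      have dimW: "kv.dim ?W + 1 = kv.dim V" using V less.prems by simp
      have sub: "mult_vars ?W \<subseteq> V" using V mult_quot_vars_subset by blast
      have "kv.dim ?W < kv.dim (mult_vars ?W)" using W False by (intro dim_mult_vars_greater)
      then have eq: "mult_vars ?W = V"
        using dimW W V sub by (intro kv.fin_dim_eqI) (simp_all add: vars_intros)
      have "minimal_growth ?W" unfolding minimal_growth_def eq using W dimW by simp
      then obtain h e where h: "h \<noteq> 0" "?W = kv.span {h * varX ^ (e - i) * varY ^ i |i. i \<le> e}"
        using less.hyps[of ?W] dimW False by auto
      let ?S = "{h * varX ^ (e - i) * varY ^ i |i. i \<le> e}"
      have AB: "(*) varX ` ?S \<union> (*) varY ` ?S = {h * varX ^ (Suc e - i) * varY ^ i |i. i \<le> Suc e}"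
        (is "?A = ?B")
      proof
        have "varX * (h * varX ^ (e - i) * varY ^ i) = h * varX ^ (Suc e - i) * varY ^ i"
          "varY * (h * varX ^ (e - i) * varY ^ i) = h * varX ^ (Suc e - Suc i) * varY ^ Suc i"
          if "i \<le> e" for i
          using that by (simp_all add: Suc_diff_le algebra_simps)
        then show "?A \<subseteq> ?B" by fastforce
        show "?B \<subseteq> ?A"
        proof
          fix f assume "f \<in> ?B"
          then obtain i where i: "i \<le> Suc e" "f = h * varX ^ (Suc e - i) * varY ^ i" by blast
          show "f \<in> ?A"
          proof (cases i)
            case 0
            then have "f = varX * (h * varX ^ (e - 0) * varY ^ 0)"
              using i by (simp add: algebra_simps)
            then show ?thesis by blast
          next
            case (Suc j)
            then have "f = varY * (h * varX ^ (e - j) * varY ^ j)" "j \<le> e"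
              using i by (simp_all add: algebra_simps)
            then show ?thesis by blast
          qed
        qed
      qed
      have "mult_vars ?W = kv.span ?B" unfolding h(2) AB[symmetric] by (rule mult_vars_span)
      then have "V = kv.span ?B" unfolding eq .
      then show ?thesis using h(1) by blast
    qed
  qed
  then show thesis using that by blast
qed

section \<open>Graded ideals\<close>

definition hom_comp :: "nat \<Rightarrow> 'k::field poly poly \<Rightarrow> 'k poly poly"
  where "hom_comp n f = (\<Sum>j\<le>n. monom (monom (coeff (coeff f j) (n - j)) (n - j)) j)"

lemma poly_poly_eqI: "(\<And>i j. coeff (coeff f j) i = coeff (coeff g j) i) \<Longrightarrow> f = g"
  by (simp add: poly_eq_iff)

lemma coeff_hom_comp:
  "coeff (coeff (hom_comp n f) j) i = (if i + j = n then coeff (coeff f j) i else 0)"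
proof -
  have "coeff (coeff (hom_comp n f) j) i =
      (\<Sum>b\<le>n. if b = j then coeff (monom (coeff (coeff f j) (n - j)) (n - j)) i else 0)"
    unfolding hom_comp_def coeff_sum by (intro sum.cong) simp_all
  then show ?thesis by auto
qed

lemma hom_comp_add: "hom_comp n (f + g) = hom_comp n f + hom_comp n g"
  by (rule poly_poly_eqI) (simp add: coeff_hom_comp)

lemma hom_comp_zero [simp]: "hom_comp n 0 = 0"
  by (rule poly_poly_eqI) (simp add: coeff_hom_comp)

lemma form_hom_comp: "form n (hom_comp n f)"
  by (simp add: form_def coeff_hom_comp)

lemma form_zero [simp]: "form n 0"
  by (simp add: form_def)

lemma hom_comp_form: "form d f \<Longrightarrow> hom_comp n f = (if n = d then f else 0)"
  by (rule poly_poly_eqI) (auto simp: coeff_hom_comp form_def)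

text \<open>Makes \<open>form\<close> an equation, so that closure properties of forms follow from
  the rules for \<open>hom_comp\<close>.\<close>

lemma form_iff: "form n f \<longleftrightarrow> hom_comp n f = f"
  using hom_comp_form form_hom_comp by metis

lemma coeff_coeff_mult:
  "coeff (coeff (f * g) j) i =
    (\<Sum>b\<le>j. \<Sum>a\<le>i. coeff (coeff f b) a * coeff (coeff g (j - b)) (i - a))"
  by (simp add: coeff_mult coeff_sum)

text \<open>In the convolution, a nonzero coefficient of \<open>g\<close> has exponents of total
  degree \<open>d\<close>, so its term contributes to degree \<open>n\<close> exactly if the
  exponents taken from \<open>f\<close> have total degree \<open>n - d\<close>.\<close>

lemma hom_comp_mult_form:
  assumes "form d g"
  shows "hom_comp n (f * g) = (if d \<le> n then hom_comp (n - d) f * g else 0)"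
proof (rule poly_poly_eqI)
  fix i j
  have "(if i + j = n then coeff (coeff f b) a * coeff (coeff g (j - b)) (i - a) else 0) =
      (if d \<le> n then coeff (coeff (hom_comp (n - d) f) b) a * coeff (coeff g (j - b)) (i - a) else 0)"
    if "a \<le> i" "b \<le> j" for a b
  proof (cases "coeff (coeff g (j - b)) (i - a) = 0")
    case False
    then have "i - a + (j - b) = d" using assms by (simp add: form_def)
    then have "i + j = a + b + d" using that by simp
    then show ?thesis by (auto simp: coeff_hom_comp)
  qed simp
  then have "(\<Sum>b\<le>j. \<Sum>a\<le>i. if i + j = n then coeff (coeff f b) a * coeff (coeff g (j - b)) (i - a) else 0) =
      (\<Sum>b\<le>j. \<Sum>a\<le>i. if d \<le> n then coeff (coeff (hom_comp (n - d) f) b) a * coeff (coeff g (j - b)) (i - a) else 0)"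
    by (intro sum.cong refl) auto
  then show "coeff (coeff (hom_comp n (f * g)) j) i =
      coeff (coeff (if d \<le> n then hom_comp (n - d) f * g else 0) j) i"
    by (auto simp: coeff_hom_comp coeff_coeff_mult)
qed

lemma form_mult: "form m f \<Longrightarrow> form n g \<Longrightarrow> form (m + n) (f * g)"
  by (simp add: form_iff[of "m + n"] hom_comp_mult_form) (simp add: form_iff)

lemma form_vars: "form 1 varX" "form 1 varY"
  by (auto simp: form_def varX_def varY_def split: if_splits)

lemma form_scalar: "form 0 (scalar c)"
  by (auto simp: form_def scalar_def coeff_pCons split: nat.splits)

lemma hom_comp_0: "hom_comp 0 f = scalar (coeff (coeff f 0) 0)"
  by (simp add: hom_comp_def scalar_def monom_0)

lemma form_add: "form n f \<Longrightarrow> form n g \<Longrightarrow> form n (f + g)"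
  by (simp add: form_iff hom_comp_add)

lemma form_scale: "form n f \<Longrightarrow> form n (scalar c * f)"
  using form_mult[OF form_scalar] by force

lemma form_Suc_vars_iff:
  "form (Suc n) (varX * f) \<longleftrightarrow> form n f" "form (Suc n) (varY * f) \<longleftrightarrow> form n f"
  unfolding form_iff mult.commute[of _ f]
  by (simp_all add: hom_comp_mult_form[OF form_vars(1)] hom_comp_mult_form[OF form_vars(2)])

lemma form_0_vars_iff:
  "form 0 (varX * f) \<longleftrightarrow> f = 0"
  unfolding form_iff mult.commute[of _ f] by (auto simp: hom_comp_mult_form[OF form_vars(1)])

lemma finite_coeff_support: "finite {i + j |i j. coeff (coeff f j) i \<noteq> 0}"
proof (rule finite_subset)
  show "{i + j |i j. coeff (coeff f j) i \<noteq> 0} \<subseteq>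
      (\<lambda>(j, i). i + j) ` (SIGMA j:{..degree f}. {..degree (coeff f j)})"
  proof
    fix n assume "n \<in> {i + j |i j. coeff (coeff f j) i \<noteq> 0}"
    then obtain i j where ij: "n = i + j" "coeff (coeff f j) i \<noteq> 0" by blast
    then have "j \<le> degree f" "i \<le> degree (coeff f j)" by (auto intro!: le_degree)
    then show "n \<in> (\<lambda>(j, i). i + j) ` (SIGMA j:{..degree f}. {..degree (coeff f j)})"
      using ij by (intro image_eqI[of _ _ "(j, i)"]) auto
  qed
qed auto

lemma coeff_support_nonempty: "f \<noteq> 0 \<Longrightarrow> {i + j |i j. coeff (coeff f j) i \<noteq> 0} \<noteq> {}"
  using poly_poly_eqI[of f 0] by auto

lemma le_tdeg: "coeff (coeff f j) i \<noteq> 0 \<Longrightarrow> i + j \<le> tdeg f"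
  unfolding tdeg_def using finite_coeff_support by (intro Max_ge) auto

lemma sum_hom_comp: "(\<Sum>n\<le>tdeg f. hom_comp n f) = f"
proof (rule poly_poly_eqI)
  fix i j
  show "coeff (coeff (\<Sum>n\<le>tdeg f. hom_comp n f) j) i = coeff (coeff f j) i"
    using le_tdeg[of f j i] by (auto simp: coeff_sum coeff_hom_comp)
qed

lemma tdeg_form: "form d f \<Longrightarrow> f \<noteq> 0 \<Longrightarrow> tdeg f = d"
  using Max_in[OF finite_coeff_support coeff_support_nonempty, of f]
  unfolding tdeg_def form_def by auto

lemma hom_comp_tdeg_nonzero:
  assumes "f \<noteq> 0"
  shows "hom_comp (tdeg f) f \<noteq> 0"
proof -
  obtain i j where "coeff (coeff f j) i \<noteq> 0" "tdeg f = i + j"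
    using Max_in[OF finite_coeff_support coeff_support_nonempty[OF assms]]
    unfolding tdeg_def by auto
  then show ?thesis using coeff_hom_comp[of "tdeg f" f j i] by auto
qed

section \<open>Graded ideals and their components\<close>

definition graded_part :: "'k::field poly poly set \<Rightarrow> nat \<Rightarrow> 'k poly poly set"
  where "graded_part I n = {f \<in> I. form n f}"

text \<open>Closure under homogeneous components passes to intersections, sums and colons more
  directly than the existence of homogeneous generators.\<close>

definition graded_ideal :: "'k::field poly poly set \<Rightarrow> bool"
  where "graded_ideal I \<longleftrightarrow> rideal.subspace I \<and> (\<forall>f\<in>I. \<forall>n. hom_comp n f \<in> I)"

lemma ideal_subspace: "rideal.subspace I \<Longrightarrow> kv.subspace I"
  unfolding rideal.subspace_def kv.subspace_def by blast

lemma graded_ideal_homogeneous: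
  assumes "homogeneous_ideal I"
  shows "graded_ideal I"
proof -
  obtain S where S: "\<And>f. f \<in> S \<Longrightarrow> \<exists>d. form d f" "I = rideal.span S"
    using assms unfolding homogeneous_ideal_def by blast
  have "hom_comp n f \<in> rideal.span S" if "f \<in> rideal.span S" for f n
    using that
  proof (induction rule: rideal.span_induct_alt)
    case base
    show ?case by (simp add: rideal.span_zero)
  next
    case (step c x y)
    obtain d where "form d x" using S step by blast
    then have "hom_comp n (c * x) \<in> rideal.span S"
      using step rideal.span_scale[OF rideal.span_base] rideal.span_zero
      by (auto simp: hom_comp_mult_form)
    then show ?case using step by (simp add: hom_comp_add rideal.span_add)
  qed
  then show ?thesis using S by (simp add: graded_ideal_def)
qed

text \<open>If \<open>x\<close> is a form of degree \<open>d\<close>, only the constant term of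
  \<open>c\<close> contributes to degree \<open>d\<close> of \<open>c * x\<close>, and nothing
  contributes below. So in the generating degree the span over the ring is already the span over
  \<open>k\<close>.\<close>

lemma form_in_span:
  fixes S :: "'k::field poly poly set"
  assumes S: "\<And>f. f \<in> S \<Longrightarrow> form d f" and f: "f \<in> rideal.span S"
  shows "hom_comp d f \<in> kv.span S" and "n < d \<Longrightarrow> hom_comp n f = 0"
proof -
  have "hom_comp d f \<in> kv.span S \<and> (n < d \<longrightarrow> hom_comp n f = 0)" for n
    using f
  proof (induction rule: rideal.span_induct_alt)
    case base
    show ?case by (simp add: kv.span_zero)
  next
    case (step c x y)
    have "scalar (coeff (coeff c 0) 0) * x \<in> kv.span S"
      using step by (intro kv.span_scale kv.span_base)
    with step S[of x] show ?case
      by (auto simp: hom_comp_add hom_comp_mult_form hom_comp_0 intro: kv.span_add)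
  qed
  then show "hom_comp d f \<in> kv.span S" and "n < d \<Longrightarrow> hom_comp n f = 0" by blast+
qed

lemma subspace_graded_part: "kv.subspace I \<Longrightarrow> kv.subspace (graded_part I n)"
  unfolding graded_part_def kv.subspace_def by (simp add: form_add form_scale)

lemma graded_idealD:
  assumes "graded_ideal I"
  shows "rideal.subspace I" "kv.subspace I" "kv.subspace (graded_part I n)"
    "f \<in> I \<Longrightarrow> hom_comp n f \<in> graded_part I n"
  using assms ideal_subspace subspace_graded_part form_hom_comp
  unfolding graded_ideal_def by (auto simp: graded_part_def)

lemma graded_part_subset: "graded_part I n \<subseteq> I"
  by (auto simp: graded_part_def)

lemma graded_part_Int: "graded_part (I \<inter> J) n = graded_part I n \<inter> graded_part J n"
  by (auto simp: graded_part_def)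

lemma graded_ideal_Int: "graded_ideal I \<Longrightarrow> graded_ideal J \<Longrightarrow> graded_ideal (I \<inter> J)"
  by (simp add: graded_ideal_def rideal.subspace_inter)

lemma ideal_plus:
  assumes "rideal.subspace I" "rideal.subspace J"
  shows "rideal.subspace (I + J)"
proof -
  have "I + J = rideal.span (I \<union> J)"
    using assms unfolding rideal.span_Un by (auto simp: set_plus_def rideal.span_eq_iff[THEN iffD2])
  then show ?thesis by simp
qed

lemma graded_ideal_plus:
  assumes "graded_ideal I" "graded_ideal J"
  shows "graded_ideal (I + J)"
  using assms ideal_plus unfolding graded_ideal_def
  by (auto simp: hom_comp_add set_plus_intro elim!: set_plus_elim)

lemma graded_part_plus:
  assumes "graded_ideal I" "graded_ideal J"
  shows "graded_part (I + J) n = graded_part I n + graded_part J n"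
proof
  show "graded_part (I + J) n \<subseteq> graded_part I n + graded_part J n"
  proof
    fix f assume "f \<in> graded_part (I + J) n"
    then obtain u v where uv: "u \<in> I" "v \<in> J" "f = u + v" "hom_comp n f = f"
      by (auto simp: graded_part_def form_iff elim!: set_plus_elim)
    then have "f = hom_comp n u + hom_comp n v" by (simp add: hom_comp_add)
    then show "f \<in> graded_part I n + graded_part J n"
      using uv assms by (auto intro: graded_idealD(4))
  qed
qed (auto simp: graded_part_def form_add elim!: set_plus_elim)

lemma graded_subsetI:
  assumes A: "graded_ideal A" and B: "kv.subspace B"
    and sub: "\<And>n. graded_part A n \<subseteq> B"
  shows "A \<subseteq> B"
proof
  fix f assume "f \<in> A"
  then have "(\<Sum>n\<le>tdeg f. hom_comp n f) \<in> B"
    using graded_idealD(4)[OF A] sub by (intro kv.subspace_sum[OF B]) blast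
  then show "f \<in> B" by (simp add: sum_hom_comp)
qed

lemma graded_ideal_quot_vars:
  assumes "graded_ideal I"
  shows "graded_ideal (quot_vars I)"
proof -
  have "varX * hom_comp n f = hom_comp (Suc n) (varX * f)"
    "varY * hom_comp n f = hom_comp (Suc n) (varY * f)" for n and f :: "'a poly poly"
    using hom_comp_mult_form[OF form_vars(1), of "Suc n" f]
      hom_comp_mult_form[OF form_vars(2), of "Suc n" f]
    by (simp_all add: mult.commute)
  moreover have "rideal.subspace (quot_vars I)"
    using assms unfolding graded_ideal_def rideal.subspace_def quot_vars_def
    by (auto simp: distrib_left mult.left_commute)
  ultimately show ?thesis using assms by (simp add: graded_ideal_def quot_vars_def)
qed

lemma graded_part_quot_vars: "graded_part (quot_vars I) n = quot_vars (graded_part I (Suc n))"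
  by (auto simp: graded_part_def quot_vars_def form_Suc_vars_iff)

text \<open>A nonzero element would have degree -1. This covers the index \<open>0\<close>, which
  \<open>graded_part_quot_vars\<close> does not reach.\<close>

lemma quot_vars_graded_part_0:
  assumes "rideal.subspace I"
  shows "quot_vars (graded_part I 0) = {0}"
  using rideal.subspace_0[OF assms] by (auto simp: graded_part_def quot_vars_def form_0_vars_iff)

lemma mult_vars_graded_part:
  assumes "rideal.subspace I"
  shows "mult_vars (graded_part I n) \<subseteq> graded_part I (Suc n)"
  using assms
  by (auto simp: graded_part_def form_Suc_vars_iff rideal.subspace_add rideal.subspace_scale
      intro!: form_add elim!: mult_varsE)

text \<open>The variables generate the maximal ideal, so it suffices to test membership on
  them.\<close>

lemma ideal_colon_max_ideal:
  assumes "rideal.subspace I"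
  shows "ideal_colon I max_ideal = quot_vars I"
proof -
  have "f * g \<in> I" if "f \<in> quot_vars I" "g \<in> max_ideal" for f g
    using that(2) unfolding max_ideal_def
  proof (induction rule: rideal.span_induct_alt)
    case (step c x y)
    have "f * x \<in> I" using step that(1) by (auto simp: quot_vars_def mult.commute)
    then have "c * (f * x) + f * y \<in> I"
      using step
      by (intro rideal.subspace_add[OF assms] rideal.subspace_scale[OF assms, of "f * x"])
    then show ?case by (simp add: algebra_simps)
  qed (simp add: rideal.subspace_0[OF assms])
  moreover have "f \<in> quot_vars I" if "f \<in> ideal_colon I max_ideal" for f
  proof -
    have "varX \<in> max_ideal" "varY \<in> max_ideal"
      unfolding max_ideal_def by (simp_all add: rideal.span_base)
    with that have "f * varX \<in> I" "f * varY \<in> I" unfolding ideal_colon_def by blast+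
    then show ?thesis by (simp add: quot_vars_def mult.commute[of _ f])
  qed
  ultimately show ?thesis unfolding ideal_colon_def by blast
qed

text \<open>The top component of an element of least degree is nonzero and lies in the ideal;
  multiplication by the variables carries nonzero components to all higher degrees. Conversely, a
  nonzero form of degree \<open>n\<close> bounds the initial degree.\<close>

lemma init_deg_le_iff:
  assumes I: "graded_ideal I" "I \<noteq> {0}"
  shows "init_deg I \<le> n \<longleftrightarrow> graded_part I n \<noteq> {0}"
proof
  note sub = graded_idealD[OF I(1)]
  obtain f where f: "f \<in> I" "f \<noteq> 0" using I rideal.subspace_0[OF sub(1)] by blast
  then obtain g where g: "g \<in> I" "g \<noteq> 0" "tdeg g = init_deg I"
    using LeastI[of "\<lambda>d. \<exists>f\<in>I. f \<noteq> 0 \<and> tdeg f = d" "tdeg f"] unfolding init_deg_def by blast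
  have ne: "graded_part I (init_deg I) \<noteq> {0}"
    using sub(4)[OF g(1)] hom_comp_tdeg_nonzero[OF g(2)] g(3) by fastforce
  show "graded_part I n \<noteq> {0}" if "init_deg I \<le> n"
    using that
  proof (induction n rule: dec_induct)
    case (step m)
    then show ?case
      using mult_vars_graded_part[OF sub(1), of m] mult_vars_eq_zero_iff[OF sub(3), of m]
        kv.subspace_0[OF sub(3), of "Suc m"] kv.subspace_0[OF subspace_mult_vars[OF sub(3)], of m]
      by blast
  qed (rule ne)
  assume "graded_part I n \<noteq> {0}"
  then obtain h where "h \<in> I" "h \<noteq> 0" "form n h"
    using kv.subspace_0[OF sub(3), of n] by (auto simp: graded_part_def)
  then have "\<exists>f\<in>I. f \<noteq> 0 \<and> tdeg f = n" using tdeg_form by blast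
  then show "init_deg I \<le> n" unfolding init_deg_def by (rule Least_le)
qed

section \<open>The criterion in terms of minimal growth\<close>

lemma ideal_Int_nonzero:
  fixes I J :: "'a::idom set"
  assumes "rideal.subspace I" "I \<noteq> {0}" "rideal.subspace J" "J \<noteq> {0}"
  shows "I \<inter> J \<noteq> {0}"
proof -
  obtain f g where fg: "f \<in> I" "f \<noteq> 0" "g \<in> J" "g \<noteq> 0"
    using assms rideal.subspace_0 by blast
  have "f * g \<in> J" "g * f \<in> I"
    using fg rideal.subspace_scale assms by blast+
  then show ?thesis using fg by (metis Int_iff mult.commute mult_eq_0_iff singletonD)
qed

lemma minimal_growth_sum_iff:
  assumes I: "graded_ideal I" "I \<noteq> {0}" and J: "graded_ideal J" "J \<noteq> {0}"
    and gI: "\<And>n. minimal_growth (graded_part I n)" and gJ: "\<And>n. minimal_growth (graded_part J n)"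
  shows "(\<forall>n. minimal_growth (graded_part (I + J) n)) \<longleftrightarrow>
    init_deg (I \<inter> J) = max (init_deg I) (init_deg J) \<or>
    (init_deg (I \<inter> J) = max (init_deg I) (init_deg J) + 1 \<and>
     ideal_colon (I + J) max_ideal \<noteq> ideal_colon I max_ideal + ideal_colon J max_ideal)"
proof -
  define b where "b = max (init_deg I) (init_deg J)"
  define V where "V n = graded_part I n" for n
  define U where "U n = graded_part J n" for n
  note subI = graded_idealD[OF I(1)] and subJ = graded_idealD[OF J(1)]
  note sub = subI(3)[folded V_def] subJ(3)[folded U_def]
  note gV = gI[folded V_def] and gU = gJ[folded U_def]
  have plus: "graded_part (I + J) n = V n + U n" for n
    unfolding V_def U_def using I J by (intro graded_part_plus)
  have zero_iff: "V n \<inter> U n \<noteq> {0} \<longleftrightarrow> init_deg (I \<inter> J) \<le> n" for n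
    unfolding V_def U_def graded_part_Int[symmetric] using I J subI subJ
    by (intro init_deg_le_iff[symmetric] graded_ideal_Int ideal_Int_nonzero)
  have nonzero: "V n \<noteq> {0} \<longleftrightarrow> init_deg I \<le> n" "U n \<noteq> {0} \<longleftrightarrow> init_deg J \<le> n" for n
    unfolding V_def U_def using I J by (simp_all add: init_deg_le_iff)
  have below: "V n = {0} \<or> U n = {0}" if "n < b" for n
    using that nonzero[of n] unfolding b_def by linarith
  have above: "V n \<noteq> {0}" "U n \<noteq> {0}" if "b \<le> n" for n
    using that nonzero[of n] unfolding b_def by auto
  have b_le: "b \<le> init_deg (I \<inter> J)"
  proof (rule ccontr)
    assume "\<not> ?thesis"
    then have "V (init_deg (I \<inter> J)) \<inter> U (init_deg (I \<inter> J)) = {0}"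
      using below kv.subspace_0[OF sub(1)] kv.subspace_0[OF sub(2)]
      by (metis Int_insert_left_if1 Int_insert_right_if1 inf_bot_left inf_bot_right not_le)
    then show False using zero_iff by blast
  qed
  \<comment> \<open>From degree \<open>b\<close> on, \<open>K n\<close> is the condition for minimal
    growth of \<open>V n + U n\<close>. It holds as soon as \<open>V n\<close> and
    \<open>U n\<close> meet nontrivially, and it makes them meet in degree
    \<open>n + 1\<close>.\<close>
  define K where "K n \<longleftrightarrow> mult_vars (V n) \<inter> mult_vars (U n) \<noteq> {0}" for n
  have KI: "K n" if "init_deg (I \<inter> J) \<le> n" for n
  proof -
    have "V n \<inter> U n \<noteq> {0}" "0 \<in> V n \<inter> U n"
      using that zero_iff sub by (simp_all add: kv.subspace_0)
    then obtain f where "f \<in> V n" "f \<in> U n" "f \<noteq> 0" by blast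
    then have "varX * f \<in> mult_vars (V n) \<inter> mult_vars (U n)" "varX * f \<noteq> 0"
      by (simp_all add: mult_vars_mem sub)
    then show ?thesis unfolding K_def by blast
  qed
  have KD: "init_deg (I \<inter> J) \<le> Suc n" if "K n" for n
  proof -
    have "0 \<in> mult_vars (V n) \<inter> mult_vars (U n)"
      using sub by (simp add: kv.subspace_0 subspace_mult_vars)
    moreover have "mult_vars (V n) \<inter> mult_vars (U n) \<noteq> {0}"
      using that by (simp add: K_def)
    ultimately obtain f where "f \<in> mult_vars (V n)" "f \<in> mult_vars (U n)" "f \<noteq> 0"
      by blast
    moreover have "mult_vars (V n) \<subseteq> V (Suc n)" "mult_vars (U n) \<subseteq> U (Suc n)"
      unfolding V_def U_def using subI(1) subJ(1) by (simp_all add: mult_vars_graded_part)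
    ultimately show ?thesis unfolding zero_iff[symmetric] by blast
  qed
  have growth: "minimal_growth (V n + U n) \<longleftrightarrow> K n" if "b \<le> n" for n
    unfolding K_def by (rule minimal_growth_plus_iff) (use gV gU above[OF that] in auto)
  \<comment> \<open>Only degree \<open>b\<close> matters. Below it one summand vanishes; above it
    \<open>K b\<close> gives \<open>init_deg (I \<inter> J) \<le> b + 1 \<le> n\<close>, hence
    \<open>K n\<close>.\<close>
  have CL: "(\<forall>n. minimal_growth (V n + U n)) \<longleftrightarrow> K b"
  proof
    assume K: "K b"
    show "\<forall>n. minimal_growth (V n + U n)"
    proof
      fix n
      consider "n < b" | "n = b" | "Suc b \<le> n" by linarith
      then show "minimal_growth (V n + U n)"
      proof cases
        case 1
        then show ?thesis using below[of n] gV[of n] gU[of n] by auto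
      next
        case 2
        then show ?thesis using K growth[of n] by simp
      next
        case 3
        then have "K n" using KI[of n] KD[OF K] by simp
        then show ?thesis using growth[of n] 3 by simp
      qed
    qed
  qed (use growth[of b] in simp)
  have colon: "ideal_colon (I + J) max_ideal = quot_vars (I + J)"
    "ideal_colon I max_ideal = quot_vars I" "ideal_colon J max_ideal = quot_vars J"
    using subI subJ by (simp_all add: ideal_colon_max_ideal ideal_plus)
  have quot_part: "graded_part (quot_vars (I + J)) n = quot_vars (V (Suc n) + U (Suc n))"
    "graded_part (quot_vars I + quot_vars J) n = quot_vars (V (Suc n)) + quot_vars (U (Suc n))" for n
    using I J by (simp_all add: graded_part_quot_vars plus graded_part_plus graded_ideal_quot_vars
        V_def U_def)
  have "K b" if "init_deg (I \<inter> J) = b"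
    using KI that by simp
  \<comment> \<open>The colon ideals differ in degree \<open>b - 1\<close>, the one determined by
    \<open>V b\<close> and \<open>U b\<close>.\<close>
  moreover have "quot_vars (I + J) \<noteq> quot_vars I + quot_vars J"
    if "K b" "init_deg (I \<inter> J) \<noteq> b"
  proof
    assume eq: "quot_vars (I + J) = quot_vars I + quot_vars J"
    have "V b \<inter> U b = {0}" using zero_iff[of b] b_le that by auto
    moreover have "minimal_growth (V b + U b)" using growth that by simp
    ultimately have not: "\<not> quot_vars (V b + U b) \<subseteq> quot_vars (V b) + quot_vars (U b)"
      using quot_vars_plus_Int_zero[OF gV above(1) gU above(2)] by simp
    \<comment> \<open>For \<open>b = 0\<close> there is no degree \<open>b - 1\<close>; there
      \<open>quot_vars (V b + U b)\<close> is zero, so the inclusion refuted above holds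
      trivially.\<close>
    show False
    proof (cases b)
      case 0
      then have "quot_vars (V b + U b) = {0}"
        using quot_vars_graded_part_0[OF ideal_plus[OF subI(1) subJ(1)]] plus by simp
      then show ?thesis
        using not kv.subspace_0[OF kv.subspace_set_plus[OF subspace_quot_vars[OF sub(1)]
              subspace_quot_vars[OF sub(2)]]] by auto
    next
      case (Suc m)
      then show ?thesis using not quot_part[of m] eq by simp
    qed
  qed
  \<comment> \<open>Without \<open>K b\<close> the colon ideals agree in every degree: one summand
    is zero below \<open>b\<close>, the sum of the \<open>mult_vars\<close> is direct at
    \<open>b\<close>, and \<open>V n\<close> and \<open>U n\<close> meet nontrivially above
    \<open>b\<close>.\<close>
  moreover have "K b" if init: "init_deg (I \<inter> J) = b + 1"
    and neq: "quot_vars (I + J) \<noteq> quot_vars I + quot_vars J"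
  proof (rule ccontr)
    assume "\<not> K b"
    have "quot_vars (V n + U n) \<subseteq> quot_vars (V n) + quot_vars (U n)" for n
    proof -
      consider "n < b" | "n = b" | "Suc b \<le> n" by linarith
      then show ?thesis
      proof cases
        case 1
        then show ?thesis using below[of n] by auto
      next
        case 2
        then show ?thesis using quot_vars_plus_direct[OF sub] \<open>\<not> K b\<close> K_def by blast
      next
        case 3
        then show ?thesis
          using quot_vars_plus_Int_nonzero[OF gV gU] zero_iff[of n] init by simp
      qed
    qed
    then have "graded_part (quot_vars (I + J)) n \<subseteq> graded_part (quot_vars I + quot_vars J) n" for n
      unfolding quot_part by blast
    then have "graded_part (quot_vars (I + J)) n \<subseteq> quot_vars I + quot_vars J" for n
      using graded_part_subset by (rule order_trans)
    then have "quot_vars (I + J) \<subseteq> quot_vars I + quot_vars J"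
      using graded_subsetI[OF graded_ideal_quot_vars[OF graded_ideal_plus[OF I(1) J(1)]]
          kv.subspace_set_plus[OF subspace_quot_vars[OF subI(2)] subspace_quot_vars[OF subJ(2)]]]
      by blast
    moreover have "quot_vars I + quot_vars J \<subseteq> quot_vars (I + J)"
      by (rule quot_vars_plus_supset[OF subI(2) subJ(2)])
    ultimately show False using neq by simp
  qed
  moreover have "init_deg (I \<inter> J) = b \<or> init_deg (I \<inter> J) = b + 1" if "K b"
    using KD[OF that] b_le by linarith
  ultimately show ?thesis unfolding plus CL colon b_def[symmetric] by blast
qed

section \<open>Linear syzygies\<close>

text \<open>Stated for modules to serve both \<open>kv\<close> and \<open>rideal\<close>, and for
  families because generators are indexed by the columns of a matrix and need not be
  distinct.\<close>

lemma (in module) span_image_family: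
  assumes "finite A"
  shows "span (g ` A) = range (\<lambda>c. \<Sum>i\<in>A. scale (c i) (g i))"
proof
  have "subspace (range (\<lambda>c. \<Sum>i\<in>A. scale (c i) (g i)))"
  proof (rule subspaceI)
    show "0 \<in> range (\<lambda>c. \<Sum>i\<in>A. scale (c i) (g i))"
      by (rule range_eqI[of _ _ "\<lambda>_. 0"]) simp
    fix x y assume "x \<in> range (\<lambda>c. \<Sum>i\<in>A. scale (c i) (g i))" "y \<in> range (\<lambda>c. \<Sum>i\<in>A. scale (c i) (g i))"
    then obtain c d where "x = (\<Sum>i\<in>A. scale (c i) (g i))" "y = (\<Sum>i\<in>A. scale (d i) (g i))" by blast
    then show "x + y \<in> range (\<lambda>c. \<Sum>i\<in>A. scale (c i) (g i))"
      by (intro range_eqI[of _ _ "\<lambda>i. c i + d i"]) (simp add: scale_left_distrib sum.distrib)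
  next
    fix a x assume "x \<in> range (\<lambda>c. \<Sum>i\<in>A. scale (c i) (g i))"
    then obtain c where "x = (\<Sum>i\<in>A. scale (c i) (g i))" by blast
    then show "scale a x \<in> range (\<lambda>c. \<Sum>i\<in>A. scale (c i) (g i))"
      by (intro range_eqI[of _ _ "\<lambda>i. a * c i"]) (simp add: scale_sum_right)
  qed
  moreover have "g ` A \<subseteq> range (\<lambda>c. \<Sum>i\<in>A. scale (c i) (g i))"
  proof
    fix x assume "x \<in> g ` A"
    then obtain k where k: "k \<in> A" "x = g k" by blast
    have "(\<Sum>i\<in>A. scale (if i = k then 1 else 0) (g i)) = (\<Sum>i\<in>A. if i = k then g i else 0)"
      by (rule sum.cong) auto
    with k assms have "x = (\<Sum>i\<in>A. scale (if i = k then 1 else 0) (g i))" by simp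
    then show "x \<in> range (\<lambda>c. \<Sum>i\<in>A. scale (c i) (g i))" by (rule range_eqI[of _ _ "\<lambda>i. if i = k then 1 else 0"])
  qed
  ultimately show "span (g ` A) \<subseteq> range (\<lambda>c. \<Sum>i\<in>A. scale (c i) (g i))"
    by (intro span_minimal)
  show "range (\<lambda>c. \<Sum>i\<in>A. scale (c i) (g i)) \<subseteq> span (g ` A)"
    by (auto intro: span_sum[OF span_scale[OF span_base]])
qed

text \<open>Padding the system with zero rows gives a square matrix of determinant zero, which over
  an integral domain has a nonzero kernel vector.\<close>

lemma homogeneous_system_nontrivial:
  fixes u :: "nat \<Rightarrow> 'b \<Rightarrow> 'a::idom"
  assumes B: "finite B" "card B < m"
  shows "\<exists>v. (\<exists>t<m. v t \<noteq> 0) \<and> (\<forall>b\<in>B. (\<Sum>t<m. u t b * v t) = 0)"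
proof -
  obtain f where f: "bij_betw f {..<card B} B"
    using ex_bij_betw_nat_finite[OF B(1)] by (auto simp: atLeast0LessThan)
  define A where "A = mat m m (\<lambda>(i, t). if i < card B then u t (f i) else 0)"
  have A: "A \<in> carrier_mat m m" by (simp add: A_def)
  have "det A = 0"
    using B(2) by (subst laplace_expansion_row[OF A B(2)]) (simp add: A_def)
  then obtain w where w: "w \<in> carrier_vec m" "w \<noteq> 0\<^sub>v m" "A *\<^sub>v w = 0\<^sub>v m"
    using det_0_iff_vec_prod_zero[OF A] by blast
  have "\<exists>t<m. w $ t \<noteq> 0" using w(1,2) by auto
  moreover have "(\<Sum>t<m. u t b * w $ t) = 0" if "b \<in> B" for b
  proof -
    have "b \<in> f ` {..<card B}" using f that by (simp add: bij_betw_imp_surj_on)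
    then obtain i where i: "i < card B" "b = f i" by blast
    have "(A *\<^sub>v w) $ i = (\<Sum>t<m. u t b * w $ t)"
      using i B(2) w(1) by (simp add: A_def scalar_prod_def atLeast0LessThan)
    then show ?thesis using w(3) i B(2) by simp
  qed
  ultimately show ?thesis by blast
qed

lemma form_1_decompose:
  assumes "form 1 f"
  shows "f = varX * scalar (coeff (coeff f 0) 1) + varY * scalar (coeff (coeff f 1) 0)"
  using assms unfolding form_iff
  by (subst (asm) hom_comp_def) (simp add: varX_def varY_def scalar_def monom_altdef)

lemma scalar_sum: "scalar (\<Sum>i\<in>A. c i) = (\<Sum>i\<in>A. scalar (c i))"
  by (induction A rule: infinite_finite_induct) (simp_all add: scalar_hom)

lemma scalar_minus: "scalar (- a) = - scalar a"
  by (simp add: scalar_def)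

text \<open>
  A linear syzygy is a pair of expressions for \<open>y w\<close> and \<open>x w\<close> with \<open>w \<in> V : \<mm>\<close>, so there are
  \<open>dim (V : \<mm>)\<close> of them over \<open>k\<close>. If they generate all syzygies, then they generate the \<open>n - 1\<close>
  Koszul syzygies \<open>g\<^sub>t e\<^sub>0 - g\<^sub>0 e\<^sub>t\<close>, which are independent over \<open>R\<close>.
\<close>

lemma linear_syzygies_bound:
  fixes g :: "nat \<Rightarrow> 'k::field poly poly"
  assumes indep: "\<And>c p. (\<Sum>p<n. scalar (c p) * g p) = 0 \<Longrightarrow> p < n \<Longrightarrow> c p = 0"
    and linear: "\<And>v. (\<Sum>p<n. v p * g p) = 0 \<Longrightarrow> \<exists>(m::nat) M w.
      (\<forall>p<n. v p = (\<Sum>q<m. w q * M p q)) \<and> (\<forall>p<n. \<forall>q<m. form 1 (M p q)) \<and>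
      (\<forall>q<m. (\<Sum>p<n. M p q * g p) = 0)"
  shows "n \<le> kv.dim (quot_vars (kv.span (g ` {..<n}))) + 1"
proof (rule ccontr)
  let ?V = "kv.span (g ` {..<n})" and ?W = "quot_vars (kv.span (g ` {..<n}))"
  assume "\<not> ?thesis"
  then have less: "kv.dim ?W + 1 < n" by simp
  have V: "kv.subspace ?V" "kv.fin_dim ?V" unfolding kv.fin_dim_def by blast+
  obtain B where B: "B \<subseteq> ?W" "kv.span B = ?W" "finite B" "card B = kv.dim ?W"
    using kv.fin_dim_basis[OF vars_intros(3,4)] V by metis
  have V_eq: "?V = range (\<lambda>c. \<Sum>p<n. scalar (c p) * g p)"
    by (rule kv.span_image_family) simp
  define coord where "coord f = (SOME c. f = (\<Sum>p<n. scalar (c p) * g p))" for f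
  have coord: "f = (\<Sum>p<n. scalar (coord f p) * g p)" if "f \<in> ?V" for f
    unfolding coord_def by (rule someI_ex[of "\<lambda>c. f = (\<Sum>p<n. scalar (c p) * g p)"]) (use that V_eq in auto)
  define \<alpha> \<beta> where "\<alpha> b = coord (varY * b)" and "\<beta> b = coord (varX * b)" for b
  have coords: "varY * b = (\<Sum>p<n. scalar (\<alpha> b p) * g p)"
      "varX * b = (\<Sum>p<n. scalar (\<beta> b p) * g p)" if "b \<in> B" for b
    unfolding \<alpha>_def \<beta>_def by (rule coord, use that B(1) in \<open>auto simp: quot_vars_def\<close>)+
  \<comment> \<open>The linear syzygy attached to \<open>b\<close>: it expresses
    \<open>x (y b) - y (x b) = 0\<close> in the generators \<open>g\<close>.\<close>
  define C where "C b p = varX * scalar (\<alpha> b p) - varY * scalar (\<beta> b p)" for b p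
  have unique: "c p = d p" if "(\<Sum>p<n. scalar (c p) * g p) = (\<Sum>p<n. scalar (d p) * g p)" "p < n" for c d p
  proof -
    have "scalar (c q) = scalar (c q - d q) + scalar (d q)" for q
      by (simp flip: scalar_hom)
    then have "(\<Sum>p<n. scalar (c p) * g p) =
        (\<Sum>p<n. scalar (c p - d p) * g p) + (\<Sum>p<n. scalar (d p) * g p)"
      by (simp add: sum.distrib[symmetric] distrib_right[symmetric])
    with that have "c p - d p = 0" by (intro indep) auto
    then show ?thesis by simp
  qed
  \<comment> \<open>Every linear syzygy is a combination over \<open>k\<close> of the
    \<open>C b\<close>. Splitting it into \<open>x\<close> and \<open>y\<close> parts yields a
    common \<open>w\<close> in \<open>?W\<close>; the coordinates of \<open>y w\<close> and
    \<open>x w\<close> recover the syzygy, and \<open>w\<close> is expanded in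
    \<open>B\<close>.\<close>
  have lin: "\<exists>c. \<forall>p<n. m p = (\<Sum>b\<in>B. scalar (c b) * C b p)"
    if m: "\<And>p. p < n \<Longrightarrow> form 1 (m p)" "(\<Sum>p<n. m p * g p) = 0" for m
  proof -
    define a b where "a p = coeff (coeff (m p) 0) 1" and "b p = coeff (coeff (m p) 1) 0" for p
    have ab: "m p = varX * scalar (a p) + varY * scalar (b p)" if "p < n" for p
      unfolding a_def b_def by (rule form_1_decompose[OF m(1)[OF that]])
    have "(\<Sum>p<n. m p * g p) = varX * (\<Sum>p<n. scalar (a p) * g p) + varY * (\<Sum>p<n. scalar (b p) * g p)"
      by (simp add: ab sum_distrib_left sum.distrib distrib_right mult.assoc)
    with m(2) have "varX * (\<Sum>p<n. scalar (a p) * g p) = varY * - (\<Sum>p<n. scalar (b p) * g p)"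
      by (simp add: add_eq_0_iff2)
    then obtain w where w: "(\<Sum>p<n. scalar (a p) * g p) = varY * w"
        "- (\<Sum>p<n. scalar (b p) * g p) = varX * w"
      by (rule varX_mult_eq_varY_multE)
    have negb: "- (\<Sum>p<n. scalar (b p) * g p) = (\<Sum>p<n. scalar (- b p) * g p)"
      by (simp add: scalar_minus sum_negf)
    have "w \<in> ?W"
      unfolding quot_vars_def V_eq mem_Collect_eq w(1)[symmetric] w(2)[symmetric] negb
      by (intro conjI range_eqI[of _ _ "\<lambda>p. - b p"] range_eqI[of _ _ a] refl)
    then have "w \<in> kv.span (id ` B)" using B by simp
    then obtain c where c: "w = (\<Sum>x\<in>B. scalar (c x) * x)"
      unfolding kv.span_image_family[OF B(3)] by auto
    have expand: "z * w = (\<Sum>p<n. scalar (\<Sum>x\<in>B. c x * \<gamma> x p) * g p)"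
      if \<gamma>: "\<And>x. x \<in> B \<Longrightarrow> z * x = (\<Sum>p<n. scalar (\<gamma> x p) * g p)" for z \<gamma>
    proof -
      have "z * w = (\<Sum>x\<in>B. scalar (c x) * (z * x))"
        unfolding c by (simp add: sum_distrib_left mult.left_commute)
      also have "\<dots> = (\<Sum>x\<in>B. \<Sum>p<n. scalar (c x * \<gamma> x p) * g p)"
        by (simp add: \<gamma> sum_distrib_left scalar_hom mult.assoc)
      also have "\<dots> = (\<Sum>p<n. scalar (\<Sum>x\<in>B. c x * \<gamma> x p) * g p)"
        by (subst sum.swap) (simp add: scalar_sum sum_distrib_right)
      finally show ?thesis .
    qed
    have "a p = (\<Sum>x\<in>B. c x * \<alpha> x p)" "- b p = (\<Sum>x\<in>B. c x * \<beta> x p)" if "p < n" for p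
      using unique[of a "\<lambda>p. \<Sum>x\<in>B. c x * \<alpha> x p", OF _ that]
        unique[of "\<lambda>p. - b p" "\<lambda>p. \<Sum>x\<in>B. c x * \<beta> x p", OF _ that]
        expand[OF coords(1)] expand[OF coords(2)] w negb by auto
    then have a: "a p = (\<Sum>x\<in>B. c x * \<alpha> x p)" and b: "b p = - (\<Sum>x\<in>B. c x * \<beta> x p)" if "p < n" for p
      using that by (metis minus_minus)+
    have "m p = (\<Sum>x\<in>B. scalar (c x) * C x p)" if "p < n" for p
    proof -
      have "scalar (b p) = - scalar (\<Sum>x\<in>B. c x * \<beta> x p)"
        unfolding b[OF that] by (rule scalar_minus)
      then have "m p = varX * (\<Sum>x\<in>B. scalar (c x) * scalar (\<alpha> x p)) -
          varY * (\<Sum>x\<in>B. scalar (c x) * scalar (\<beta> x p))"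
        by (simp add: ab[OF that] a[OF that] scalar_sum scalar_hom)
      then show ?thesis
        by (simp add: C_def sum_distrib_left sum_subtractf right_diff_distrib mult.left_commute)
    qed
    then show ?thesis by blast
  qed
  have gen: "\<exists>u. \<forall>p<n. v p = (\<Sum>b\<in>B. u b * C b p)" if v0: "(\<Sum>p<n. v p * g p) = 0" for v
  proof -
    obtain m M w where M: "\<forall>p<n. v p = (\<Sum>q<(m::nat). w q * M p q)"
        "\<forall>p<n. \<forall>q<m. form 1 (M p q)" "\<forall>q<m. (\<Sum>p<n. M p q * g p) = 0"
      using linear[OF v0] by blast
    have "\<forall>q. \<exists>c. q < m \<longrightarrow> (\<forall>p<n. M p q = (\<Sum>b\<in>B. scalar (c b) * C b p))"
      using lin[of "\<lambda>p. M p _"] M by simp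
    from choice[OF this] obtain c
      where c: "\<And>q p. q < m \<Longrightarrow> p < n \<Longrightarrow> M p q = (\<Sum>b\<in>B. scalar (c q b) * C b p)"
      by blast
    have "v p = (\<Sum>b\<in>B. (\<Sum>q<m. w q * scalar (c q b)) * C b p)" if "p < n" for p
    proof -
      have "v p = (\<Sum>q<m. \<Sum>b\<in>B. w q * scalar (c q b) * C b p)"
        using M(1) that by (simp add: c sum_distrib_left mult.assoc)
      also have "\<dots> = (\<Sum>b\<in>B. (\<Sum>q<m. w q * scalar (c q b)) * C b p)"
        by (subst sum.swap) (simp add: sum_distrib_right)
      finally show ?thesis .
    qed
    then show ?thesis by (intro exI[of _ "\<lambda>b. \<Sum>q<m. w q * scalar (c q b)"]) simp
  qed
  have "0 < n" using less by simp
  have g0: "g 0 \<noteq> 0"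
  proof
    assume "g 0 = 0"
    then have "(\<Sum>p<n. scalar (if p = 0 then 1 else 0) * g p) = 0" by (intro sum.neutral) auto
    from indep[OF this \<open>0 < n\<close>] show False by simp
  qed
  \<comment> \<open>The Koszul syzygies of \<open>g 0\<close> with each other generator;
    \<open>t\<close> stands for the generator \<open>Suc t\<close>, so there are
    \<open>n - 1\<close> of them.\<close>
  define z where "z t p = (if p = 0 then g (Suc t) else if p = Suc t then - g 0 else 0)" for t p
  have "\<forall>t. \<exists>u. t < n - 1 \<longrightarrow> (\<forall>p<n. z t p = (\<Sum>b\<in>B. u b * C b p))"
  proof
    fix t
    show "\<exists>u. t < n - 1 \<longrightarrow> (\<forall>p<n. z t p = (\<Sum>b\<in>B. u b * C b p))"
    proof (cases "t < n - 1")
      case True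
      then have "(\<Sum>p<n. z t p * g p) = (\<Sum>p\<in>{0, Suc t}. z t p * g p)"
        by (intro sum.mono_neutral_right) (auto simp: z_def)
      also have "\<dots> = 0" by (simp add: z_def)
      finally show ?thesis using gen by blast
    qed simp
  qed
  from choice[OF this] obtain u
    where u: "\<And>t p. t < n - 1 \<Longrightarrow> p < n \<Longrightarrow> z t p = (\<Sum>b\<in>B. u t b * C b p)"
    by blast
  \<comment> \<open>More Koszul syzygies than elements of \<open>B\<close>, so their coefficient
    vectors \<open>u t\<close> satisfy a nontrivial relation \<open>v\<close> over the ring.\<close>
  have "card B < n - 1" using B(4) less by simp
  from homogeneous_system_nontrivial[OF B(3) this, of u] obtain v
    where v: "\<exists>t<n - 1. v t \<noteq> 0" "\<forall>b\<in>B. (\<Sum>t<n - 1. u t b * v t) = 0"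
    by blast
  \<comment> \<open>In coordinate \<open>Suc s\<close> only the Koszul syzygy with index
    \<open>s\<close> is nonzero, with entry \<open>- g 0\<close>; this isolates
    \<open>v s\<close>.\<close>
  have "v s = 0" if s: "s < n - 1" for s
  proof -
    have "(\<Sum>t<n - 1. z t (Suc s) * v t) = (\<Sum>t<n - 1. \<Sum>b\<in>B. C b (Suc s) * (u t b * v t))"
      using s by (intro sum.cong) (simp_all add: u sum_distrib_left sum_distrib_right ac_simps)
    also have "\<dots> = (\<Sum>b\<in>B. C b (Suc s) * (\<Sum>t<n - 1. u t b * v t))"
      by (subst sum.swap) (simp add: sum_distrib_left)
    also have "\<dots> = 0" using v(2) by simp
    finally have "(\<Sum>t<n - 1. z t (Suc s) * v t) = 0" .
    moreover have "(\<Sum>t<n - 1. z t (Suc s) * v t) = (\<Sum>t<n - 1. if t = s then - g 0 * v t else 0)"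
      by (intro sum.cong) (auto simp: z_def)
    ultimately show ?thesis using s g0 by simp
  qed
  then show False using v(1) by blast
qed

section \<open>Resolutions\<close>

lemma subspace_max_ideal: "rideal.subspace max_ideal"
  unfolding max_ideal_def by simp

lemma hom_comp_0_max_ideal:
  assumes "f \<in> max_ideal"
  shows "hom_comp 0 f = 0"
  by (rule form_in_span(2)[of "{varX, varY}" 1]) (use assms form_vars in \<open>auto simp: max_ideal_def\<close>)

lemma form_uminus: "form n f \<Longrightarrow> form n (- f)"
  by (simp add: form_def)

lemma mult_mat_vec_nth:
  assumes "A \<in> carrier_mat n m" "v \<in> carrier_vec m" "i < n"
  shows "(A *\<^sub>v v) $ i = (\<Sum>j<m. A $$ (i, j) * v $ j)"
  using assms by (simp add: scalar_prod_def atLeast0LessThan)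

lemma mat_rangeI: "A \<in> carrier_mat n m \<Longrightarrow> v \<in> carrier_vec m \<Longrightarrow> A *\<^sub>v v \<in> mat_range A"
  unfolding mat_range_def by blast

lemma one_row_mult_eq_zero_iff:
  assumes "A \<in> carrier_mat 1 n"
  shows "A *\<^sub>v v = 0\<^sub>v 1 \<longleftrightarrow> (A *\<^sub>v v) $ 0 = 0"
proof
  assume "(A *\<^sub>v v) $ 0 = 0"
  with assms show "A *\<^sub>v v = 0\<^sub>v 1" by (intro eq_vecI) auto
qed simp

text \<open>The regularity bound and the absence of forms below \<open>d\<close> put all generators
  in degree \<open>d\<close>, and with minimality the first syzygies become linear. The bound on
  linear syzygies then applies to the generators, which are independent over
  \<open>k\<close>.\<close>

lemma minimal_growth_of_resolution:
  fixes L :: "'k::field poly poly set"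
  assumes res: "minimal_graded_free_resolution L a E D"
    and reg: "\<And>i j. j \<in> set (a i) \<Longrightarrow> int j - int i \<le> int d"
    and low: "\<And>f n. f \<in> L \<Longrightarrow> form n f \<Longrightarrow> n < d \<Longrightarrow> f = 0"
  shows "minimal_growth (graded_part L d)"
proof -
  define n m where "n = length (a 0)" and "m = length (a 1)"
  define g where "g p = E $$ (0, p)" for p
  have gE: "graded_map [0] (a 0) E" and gD: "graded_map (a 0) (a 1) (D 0)"
    and L: "{w $ 0 |w. w \<in> mat_range E} = L" and ker: "mat_range (D 0) = mat_kernel E"
    and min: "\<And>p q. p < n \<Longrightarrow> q < m \<Longrightarrow> D 0 $$ (p, q) \<in> max_ideal"
    using res unfolding minimal_graded_free_resolution_def n_def m_def by auto
  have E: "E \<in> carrier_mat 1 n" and D: "D 0 \<in> carrier_mat n m"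
    using gE gD unfolding graded_map_def n_def m_def by auto
  have Ev: "(E *\<^sub>v v) $ 0 = (\<Sum>p<n. v $ p * g p)" if "v \<in> carrier_vec n" for v
    using mult_mat_vec_nth[OF E that, of 0] by (simp add: g_def mult.commute)
  have kerI: "v \<in> mat_kernel E \<longleftrightarrow> v \<in> carrier_vec n \<and> (\<Sum>p<n. v $ p * g p) = 0" for v
    unfolding mat_kernel[OF E] one_row_mult_eq_zero_iff[OF E] using Ev[of v] by auto
  have span: "L = rideal.span (g ` {..<n})"
  proof -
    have "L = range (\<lambda>c. \<Sum>p<n. c p * g p)"
    proof
      show "L \<subseteq> range (\<lambda>c. \<Sum>p<n. c p * g p)"
        using E Ev unfolding L[symmetric] mat_range_def by auto
      show "range (\<lambda>c. \<Sum>p<n. c p * g p) \<subseteq> L"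
      proof
        fix f assume "f \<in> range (\<lambda>c. \<Sum>p<n. c p * g p)"
        then obtain c where "f = (\<Sum>p<n. c p * g p)" by blast
        then have "f = (E *\<^sub>v vec n c) $ 0" by (simp add: Ev)
        then show "f \<in> L" using mat_rangeI[OF E vec_carrier] unfolding L[symmetric] by blast
      qed
    qed
    then show ?thesis by (simp add: rideal.span_image_family)
  qed
  have syz: "\<exists>w. \<forall>p<n. v p = (\<Sum>q<m. w q * D 0 $$ (p, q))" if "(\<Sum>p<n. v p * g p) = 0" for v
  proof -
    have "vec n v \<in> mat_range (D 0)" unfolding ker kerI using that by simp
    then obtain w where w: "w \<in> carrier_vec m" "vec n v = D 0 *\<^sub>v w"
      unfolding mat_range_def using D by auto
    have "v p = (\<Sum>q<m. w $ q * D 0 $$ (p, q))" if "p < n" for p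
      using arg_cong[OF w(2), of "\<lambda>x. x $ p"] mult_mat_vec_nth[OF D w(1) that] that
      by (simp add: mult.commute)
    then show ?thesis by blast
  qed
  have col: "(\<Sum>p<n. D 0 $$ (p, q) * g p) = 0" if "q < m" for q
  proof -
    have "D 0 *\<^sub>v unit_vec m q \<in> mat_kernel E"
      unfolding ker[symmetric] mat_range_def using D by auto
    then show ?thesis unfolding kerI using D that by simp
  qed
  \<comment> \<open>A relation with constant coefficients is a syzygy, so by minimality its entries
    lie in \<open>max_ideal\<close>, and a constant in \<open>max_ideal\<close> is zero.\<close>
  have indep: "c p = 0" if c: "(\<Sum>p<n. scalar (c p) * g p) = 0" "p < n" for c p
  proof -
    obtain w where "scalar (c p) = (\<Sum>q<m. w q * D 0 $$ (p, q))"
      using syz[OF c(1)] c(2) by blast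
    also have "\<dots> \<in> max_ideal"
      by (intro rideal.subspace_sum rideal.subspace_scale subspace_max_ideal) (use min c(2) in auto)
    finally have "hom_comp 0 (scalar (c p)) = 0" by (rule hom_comp_0_max_ideal)
    then show ?thesis using form_scalar[of "c p"] by (simp add: form_iff)
  qed
  have gL: "g p \<in> L" if "p < n" for p
    unfolding span using that by (intro rideal.span_base) auto
  \<comment> \<open>Regularity gives degree at most \<open>d\<close>; a lower degree would make
    \<open>g p\<close> vanish, against independence.\<close>
  have deg0: "a 0 ! p = d" "form d (g p)" if "p < n" for p
  proof -
    have "g p \<noteq> 0"
    proof
      assume "g p = 0"
      then have "(\<Sum>q<n. scalar (if q = p then 1 else 0) * g q) = 0" by (intro sum.neutral) auto
      from indep[OF this that] show False by simp
    qed
    moreover have "g p = 0 \<or> form (a 0 ! p) (g p)"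
      using gE that unfolding graded_map_def g_def n_def by auto
    moreover have "a 0 ! p \<le> d" using reg[of "a 0 ! p" 0] that by (simp add: n_def)
    ultimately show "a 0 ! p = d" using low[OF gL[OF that]] by (metis le_neq_implies_less)
    then show "form d (g p)" using \<open>g p \<noteq> 0\<close> \<open>g p = 0 \<or> form (a 0 ! p) (g p)\<close> by simp
  qed
  \<comment> \<open>Regularity bounds the degree of a nonzero entry by 1, and minimality excludes
    degree 0.\<close>
  have D1: "form 1 (D 0 $$ (p, q))" if "p < n" "q < m" for p q
  proof (cases "D 0 $$ (p, q) = 0")
    case False
    then have f: "d \<le> a 1 ! q" "form (a 1 ! q - d) (D 0 $$ (p, q))"
      using gD that deg0[of p] unfolding graded_map_def n_def m_def by auto
    have "a 1 ! q \<le> d + 1" using reg[of "a 1 ! q" 1] that by (simp add: m_def)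
    moreover have "a 1 ! q - d \<noteq> 0"
      using f(2) hom_comp_0_max_ideal[OF min[OF that]] False by (metis form_iff)
    ultimately have "a 1 ! q - d = 1" by simp
    then show ?thesis using f(2) by simp
  qed simp
  have part: "graded_part L d = kv.span (g ` {..<n})"
  proof
    show "graded_part L d \<subseteq> kv.span (g ` {..<n})"
    proof
      fix f assume "f \<in> graded_part L d"
      then have "f \<in> rideal.span (g ` {..<n})" "hom_comp d f = f"
        by (simp_all add: graded_part_def span form_iff)
      then show "f \<in> kv.span (g ` {..<n})"
        using form_in_span(1)[of "g ` {..<n}" d f] deg0(2) by auto
    qed
    have "rideal.subspace L" unfolding span by simp
    then show "kv.span (g ` {..<n}) \<subseteq> graded_part L d"
      by (intro kv.span_minimal subspace_graded_part ideal_subspace)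
        (auto simp: graded_part_def gL deg0)
  qed
  have "n \<le> kv.dim (quot_vars (kv.span (g ` {..<n}))) + 1"
  proof (rule linear_syzygies_bound)
    show "c p = 0" if "(\<Sum>p<n. scalar (c p) * g p) = 0" "p < n" for c p
      using that by (rule indep)
    fix v assume "(\<Sum>p<n. v p * g p) = 0"
    then obtain w where "\<forall>p<n. v p = (\<Sum>q<m. w q * D 0 $$ (p, q))" using syz by blast
    then show "\<exists>(m::nat) M w. (\<forall>p<n. v p = (\<Sum>q<m. w q * M p q)) \<and>
        (\<forall>p<n. \<forall>q<m. form 1 (M p q)) \<and> (\<forall>q<m. (\<Sum>p<n. M p q * g p) = 0)"
      using D1 col by (intro exI[of _ m] exI[of _ "\<lambda>p q. D 0 $$ (p, q)"] exI[of _ w]) simp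
  qed
  moreover have "kv.dim (kv.span (g ` {..<n})) \<le> n"
    using kv.dim_le_card[of "kv.span (g ` {..<n})" "g ` {..<n}"] card_image_le[of "{..<n}" g]
    by simp
  moreover have "kv.fin_dim (kv.span (g ` {..<n}))" unfolding kv.fin_dim_def by blast
  ultimately show ?thesis unfolding part by (subst minimal_growth_quot_vars_iff) auto
qed

section \<open>From minimal growth to resolutions\<close>

lemma varY_dvd_cancel_varX_power:
  assumes "varX ^ k * u = varY * v"
  shows "\<exists>w. u = varY * w"
  using assms
proof (induction k arbitrary: v)
  case (Suc k)
  then have "varX * (varX ^ k * u) = varY * v" by (simp add: mult.assoc)
  then show ?case using Suc.IH by (metis varX_mult_eq_varY_multE)
qed auto

text \<open>The syzygies of the monomials of degree \<open>e\<close> are generated by the relations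
  between neighbours. All terms but the first are divisible by \<open>varY\<close>, hence so is
  \<open>v 0\<close>; removing a multiple of the first relation and cancelling \<open>varY\<close>
  leaves a syzygy for the next smaller degree.\<close>

lemma monomial_syzygies:
  assumes "(\<Sum>i\<le>e. v i * (varX ^ (e - i) * varY ^ i)) = 0"
  shows "\<exists>w. \<forall>i\<le>e. v i = (if i < e then varY * w i else 0) - (if 0 < i then varX * w (i - 1) else 0)"
  using assms
proof (induction e arbitrary: v)
  case (Suc e)
  define s where "s = (\<Sum>i\<le>e. v (Suc i) * (varX ^ (e - i) * varY ^ i))"
  have "(\<Sum>i\<le>Suc e. v i * (varX ^ (Suc e - i) * varY ^ i)) = v 0 * varX ^ Suc e + varY * s"
    unfolding sum.atMost_Suc_shift s_def sum_distrib_left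
    by (intro arg_cong2[where f = "(+)"] sum.cong) (simp_all add: mult.left_commute)
  with Suc.prems have eq: "v 0 * varX ^ Suc e + varY * s = 0" by simp
  then have "varX ^ Suc e * v 0 = varY * - s" by (simp add: add_eq_0_iff2 mult.commute)
  then obtain w0 where w0: "v 0 = varY * w0" using varY_dvd_cancel_varX_power by blast
  have "varY * (w0 * varX ^ Suc e + s) = v 0 * varX ^ Suc e + varY * s"
    unfolding w0 by (simp only: distrib_left mult.assoc)
  then have 0: "w0 * varX ^ Suc e + s = 0" using eq by simp
  \<comment> \<open>Subtracting \<open>w0\<close> times the first relation clears entry 0 and adds
    \<open>varX * w0\<close> to entry 1, which becomes entry 0 of \<open>v'\<close>.\<close>
  define v' where "v' i = v (Suc i) + (if i = 0 then varX * w0 else 0)" for i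
  have "(\<Sum>i\<le>e. v' i * (varX ^ (e - i) * varY ^ i)) =
      s + (\<Sum>i\<le>e. if i = 0 then varX * w0 * (varX ^ (e - i) * varY ^ i) else 0)"
    unfolding s_def sum.distrib[symmetric] by (intro sum.cong) (simp_all add: v'_def distrib_right)
  also have "\<dots> = w0 * varX ^ Suc e + s" by (simp add: ac_simps)
  finally obtain w where w: "\<And>i. i \<le> e \<Longrightarrow> v' i = (if i < e then varY * w i else 0) - (if 0 < i then varX * w (i - 1) else 0)"
    using Suc.IH[of v'] 0 by auto
  have "v i = (if i < Suc e then varY * case_nat w0 w i else 0) -
      (if 0 < i then varX * case_nat w0 w (i - 1) else 0)" if "i \<le> Suc e" for i
  proof (cases i)
    case (Suc k)
    then show ?thesis using w[of k] that
      by (cases k) (auto simp: v'_def algebra_simps split: if_splits)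
  qed (simp add: w0)
  then show ?case by blast
qed auto

text \<open>For exactness at the places of the resolution where the source of a map is zero.\<close>

lemma no_columns:
  assumes "A \<in> (carrier_mat n 0 :: 'a::comm_ring_1 mat set)"
  shows "mat_range A = {0\<^sub>v n}" "mat_kernel A = {0\<^sub>v 0}"
proof -
  have zero: "A *\<^sub>v v = 0\<^sub>v n" if "v \<in> carrier_vec 0" for v
    using assms that by (intro eq_vecI) (auto simp: scalar_prod_def)
  moreover have "A *\<^sub>v 0\<^sub>v 0 \<in> mat_range A" using assms by (intro mat_rangeI) auto
  ultimately show "mat_range A = {0\<^sub>v n}" using assms by (auto simp: mat_range_def)
  have "v = 0\<^sub>v 0" if "v \<in> carrier_vec 0" for v :: "'a vec"
    using that by (intro eq_vecI) auto
  then show "mat_kernel A = {0\<^sub>v 0}" unfolding mat_kernel[OF assms] using zero by auto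
qed

text \<open>The ideal is \<open>h\<close> times the \<open>e\<close>-th power of the maximal ideal.
  Its resolution has \<open>e + 1\<close> generators in degree \<open>j\<close>, \<open>e\<close>
  syzygies in degree \<open>j + 1\<close> and nothing further; \<open>B\<close> is the Hilbert-Burch
  matrix, with \<open>varY\<close> on the diagonal and \<open>- varX\<close> below it.\<close>

lemma has_regularity_of_minimal_growth:
  fixes V :: "'k::field poly poly set"
  assumes V: "minimal_growth V" "V \<noteq> {0}" and forms: "\<And>f. f \<in> V \<Longrightarrow> form j f"
  shows "has_regularity (rideal.span V) (int j)"
proof -
  obtain h e where h: "h \<noteq> 0" "V = kv.span {h * varX ^ (e - i) * varY ^ i |i. i \<le> e}"
    using minimal_growth_structure[OF V] .
  define g where "g i = h * varX ^ (e - i) * varY ^ i" for i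
  have Vg: "V = kv.span (g ` {..e})"
    unfolding h(2) by (rule arg_cong[where f = kv.span]) (auto simp: g_def)
  have g_form: "form j (g i)" if "i \<le> e" for i
    using forms that unfolding Vg by (auto intro: kv.span_base)
  define a where "a i = (if i = 0 then replicate (Suc e) j else if i = 1 then replicate e (Suc j) else [])"
    for i :: nat
  define E where "E = mat 1 (Suc e) (\<lambda>(_, i). g i)"
  define B where "B = mat (Suc e) e
      (\<lambda>(p, q). if p = q then varY else if p = Suc q then - varX else 0 :: 'k poly poly)"
  define D where "D i = (if i = 0 then B else 0\<^sub>m (length (a i)) (length (a (Suc i))))" for i
  have E: "E \<in> carrier_mat 1 (Suc e)" and B: "B \<in> carrier_mat (Suc e) e"
    by (simp_all add: E_def B_def)
  have Ev: "(E *\<^sub>v v) $ 0 = (\<Sum>i\<le>e. v $ i * g i)" if "v \<in> carrier_vec (Suc e)" for v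
    using mult_mat_vec_nth[OF E that, of 0]
    by (simp add: E_def mult.commute lessThan_Suc_atMost)
  have Bv: "(B *\<^sub>v v) $ p = (if p < e then varY * v $ p else 0) - (if 0 < p then varX * v $ (p - 1) else 0)"
    if "v \<in> carrier_vec e" "p \<le> e" for v p
  proof -
    have "(B *\<^sub>v v) $ p = (\<Sum>q<e. (if p = q then varY * v $ q else 0) - (if p = Suc q then varX * v $ q else 0))"
      using mult_mat_vec_nth[OF B that(1), of p] that(2) by (auto simp: B_def intro!: sum.cong)
    also have "\<dots> = (if p < e then varY * v $ p else 0) - (\<Sum>q<e. if p = Suc q then varX * v $ q else 0)"
      by (simp add: sum_subtractf)
    also have "(\<Sum>q<e. if p = Suc q then varX * v $ q else 0) = (if 0 < p then varX * v $ (p - 1) else 0)"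
      using that(2) by (cases p) auto
    finally show ?thesis .
  qed
  have len: "length (a 0) = Suc e" "length (a 1) = e" "\<And>i. 1 < i \<Longrightarrow> length (a i) = 0"
    by (simp_all add: a_def)
  have Dc: "D i \<in> carrier_mat (length (a i)) (length (a (Suc i)))" for i
    using B by (simp add: D_def a_def)
  \<comment> \<open>The common factor \<open>h\<close> cancels, leaving the syzygies of the
    monomials of degree \<open>e\<close>.\<close>
  have kerE: "v \<in> mat_kernel E \<longleftrightarrow> v \<in> carrier_vec (Suc e) \<and>
      (\<Sum>i\<le>e. v $ i * (varX ^ (e - i) * varY ^ i)) = 0" for v
  proof -
    have "(\<Sum>i\<le>e. v $ i * g i) = h * (\<Sum>i\<le>e. v $ i * (varX ^ (e - i) * varY ^ i))"
      by (simp add: g_def sum_distrib_left ac_simps)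
    then show ?thesis
      unfolding mat_kernel[OF E] one_row_mult_eq_zero_iff[OF E] using Ev[of v] h(1) by auto
  qed
  have span: "rideal.span V = range (\<lambda>c. \<Sum>i\<le>e. c i * g i)"
  proof -
    have "V \<subseteq> rideal.span (g ` {..e})"
      unfolding Vg by (intro kv.span_minimal rideal.span_superset ideal_subspace) simp
    moreover have "g ` {..e} \<subseteq> rideal.span V"
      unfolding Vg using kv.span_superset rideal.span_superset by (rule order_trans)
    ultimately have "rideal.span V = rideal.span (g ` {..e})"
      unfolding rideal.span_eq by blast
    then show ?thesis by (simp add: rideal.span_image_family)
  qed
  have "minimal_graded_free_resolution (rideal.span V) a E D"
    unfolding minimal_graded_free_resolution_def
  proof (intro conjI allI impI)
    show "graded_map [0] (a 0) E"
      using E g_form by (auto simp: graded_map_def a_def E_def simp del: replicate_Suc)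
    show "graded_map (a i) (a (Suc i)) (D i)" for i
      using Dc[of i] form_vars form_uminus[OF form_vars(1)]
      by (auto simp: graded_map_def D_def a_def B_def simp del: replicate_Suc)
    show "{w $ 0 |w. w \<in> mat_range E} = rideal.span V"
    proof
      show "{w $ 0 |w. w \<in> mat_range E} \<subseteq> rideal.span V"
        unfolding span mat_range_def using E Ev by auto
      show "rideal.span V \<subseteq> {w $ 0 |w. w \<in> mat_range E}"
      proof
        fix f assume "f \<in> rideal.span V"
        then obtain c where "f = (\<Sum>i\<le>e. c i * g i)" unfolding span by blast
        then have "f = (E *\<^sub>v vec (Suc e) c) $ 0" by (simp add: Ev)
        then show "f \<in> {w $ 0 |w. w \<in> mat_range E}" using mat_rangeI[OF E vec_carrier] by blast
      qed
    qed
    show "mat_range (D 0) = mat_kernel E"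
    proof
      show "mat_kernel E \<subseteq> mat_range (D 0)"
      proof
        fix v assume v: "v \<in> mat_kernel E"
        then obtain w where w: "\<forall>i\<le>e. v $ i = (if i < e then varY * w i else 0) -
            (if 0 < i then varX * w (i - 1) else 0)"
          using monomial_syzygies[of "($) v"] unfolding kerE by blast
        have "v = B *\<^sub>v vec e w"
        proof (rule eq_vecI)
          fix i assume "i < dim_vec (B *\<^sub>v vec e w)"
          then have "i \<le> e" using B by simp
          then show "v $ i = (B *\<^sub>v vec e w) $ i"
            unfolding Bv[OF vec_carrier \<open>i \<le> e\<close>] using w by auto
        qed (use v B in \<open>auto simp: kerE\<close>)
        then show "v \<in> mat_range (D 0)" using B unfolding D_def mat_range_def by auto
      qed
      show "mat_range (D 0) \<subseteq> mat_kernel E"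
      proof
        fix v assume "v \<in> mat_range (D 0)"
        then obtain w where w: "w \<in> carrier_vec e" "v = B *\<^sub>v w"
          using B unfolding D_def mat_range_def by auto
        have "(\<Sum>i\<le>e. v $ i * (varX ^ (e - i) * varY ^ i)) =
            (\<Sum>i\<le>e. if i < e then varY * w $ i * (varX ^ (e - i) * varY ^ i) else 0) -
            (\<Sum>i\<le>e. if 0 < i then varX * w $ (i - 1) * (varX ^ (e - i) * varY ^ i) else 0)"
          unfolding sum_subtractf[symmetric]
          by (intro sum.cong) (auto simp: w Bv left_diff_distrib simp del: index_mult_mat_vec)
        also have "(\<Sum>i\<le>e. if i < e then varY * w $ i * (varX ^ (e - i) * varY ^ i) else 0) =
            (\<Sum>i<e. w $ i * (varX ^ (e - i) * varY ^ Suc i))"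
          by (intro sum.mono_neutral_cong_right) (auto simp: ac_simps)
        also have "(\<Sum>i\<le>e. if 0 < i then varX * w $ (i - 1) * (varX ^ (e - i) * varY ^ i) else 0) =
            (\<Sum>i<e. w $ i * (varX ^ (e - i) * varY ^ Suc i))"
        proof (cases e)
          case (Suc k)
          show ?thesis
            unfolding Suc sum.atMost_Suc_shift lessThan_Suc_atMost
            by (simp, intro sum.cong) (simp_all add: Suc_diff_le ac_simps)
        qed simp
        finally show "v \<in> mat_kernel E" unfolding kerE using w B by simp
      qed
    qed
    show "mat_range (D (Suc i)) = mat_kernel (D i)" for i
    proof -
      have "D (Suc i) \<in> carrier_mat (length (a (Suc i))) 0"
        using Dc[of "Suc i"] len(3)[of "Suc (Suc i)"] by simp
      then have "mat_range (D (Suc i)) = {0\<^sub>v (length (a (Suc i)))}" by (rule no_columns)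
      also have "\<dots> = mat_kernel (D i)"
      proof (cases i)
        case 0
        \<comment> \<open>\<open>B\<close> is injective: its first \<open>e\<close> rows are
          triangular with \<open>varY\<close> on the diagonal, so the entries of \<open>v\<close>
          vanish one after the other.\<close>
        have "v = 0\<^sub>v e" if v: "v \<in> carrier_vec e" "B *\<^sub>v v = 0\<^sub>v (Suc e)" for v
        proof -
          have "v $ p = 0" if "p < e" for p
            using that
          proof (induction p)
            case 0
            then show ?case using Bv[OF v(1), of 0] v(2) by simp
          next
            case (Suc p)
            then show ?case using Bv[OF v(1), of "Suc p"] v(2) by simp
          qed
          then show ?thesis using v(1) by (intro eq_vecI) auto
        qed
        then show ?thesis using 0 B len(2) by (auto simp: D_def mat_kernel[OF B])
      next
        case (Suc k)
        then have "length (a (Suc i)) = 0" using len(3) by simp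
        then show ?thesis using no_columns(2)[of "D i" "length (a i)"] Dc[of i] by simp
      qed
      finally show ?thesis .
    qed
    show "D i $$ (p, q) \<in> max_ideal" if "p < length (a i)" "q < length (a (Suc i))" for i p q
    proof -
      have "varX \<in> max_ideal" "varY \<in> max_ideal"
        unfolding max_ideal_def by (simp_all add: rideal.span_base)
      then show ?thesis
        using that rideal.subspace_neg[OF subspace_max_ideal] rideal.subspace_0[OF subspace_max_ideal]
        by (auto simp: D_def B_def a_def split: if_splits)
    qed
  qed
  moreover have "int j' - int i \<le> int j" if "j' \<in> set (a i)" for i j'
    using that by (auto simp: a_def split: if_splits)
  moreover have "\<exists>i. \<exists>j'\<in>set (a i). int j = int j' - int i"
    by (rule exI[of _ 0]) (simp add: a_def)
  ultimately show ?thesis unfolding has_regularity_def by blast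
qed

text \<open>The zero component is the separate case of the definition. Otherwise each direction is
  one of the two passages between resolutions and minimal growth, applied to the ideal generated by
  the component, whose part of degree \<open>j\<close> is the component itself.\<close>

lemma linear_resolution_span_graded_part_iff:
  fixes I :: "'k::field poly poly set"
  assumes I: "rideal.subspace I"
  shows "linear_resolution (rideal.span (graded_part I j)) \<longleftrightarrow> minimal_growth (graded_part I j)"
proof (cases "graded_part I j = {0}")
  case True
  then show ?thesis by (simp add: linear_resolution_def)
next
  case False
  let ?V = "graded_part I j" and ?L = "rideal.span (graded_part I j)"
  have forms: "\<And>f. f \<in> ?V \<Longrightarrow> form j f" by (simp add: graded_part_def)
  have V0: "0 \<in> ?V" using rideal.subspace_0[OF I] by (simp add: graded_part_def)
  have LI: "?L \<subseteq> I" using I graded_part_subset by (rule rideal.span_minimal[rotated])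
  have L0: "?L \<noteq> {0}" using False V0 rideal.span_superset[of ?V] by blast
  have part: "graded_part ?L j = ?V"
    using LI rideal.span_superset[of ?V] by (auto simp: graded_part_def)
  show ?thesis
  proof
    assume "linear_resolution ?L"
    then obtain d S where S: "\<forall>f\<in>S. form d f" "?L = rideal.span S" and reg: "has_regularity ?L (int d)"
      using L0 unfolding linear_resolution_def by blast
    have "\<exists>f\<in>S. f \<noteq> 0"
    proof (rule ccontr)
      assume "\<not> ?thesis"
      then have "?L \<subseteq> {0}" unfolding S(2) by (intro rideal.span_minimal) auto
      with L0 show False using rideal.span_zero by blast
    qed
    then obtain f where f: "f \<in> S" "f \<noteq> 0" by blast
    obtain v where v: "v \<in> ?V" "v \<noteq> 0" using False V0 by blast
    \<comment> \<open>The degree \<open>d\<close> comes from some generating set of the ideal. A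
      nonzero ideal generated by forms of degree \<open>d\<close> and also by forms of degree
      \<open>j\<close> forces \<open>d = j\<close>, since neither set can contain a nonzero form
      below the degree of the other.\<close>
    have "\<not> d < j"
      using form_in_span(2)[of ?V j f d] rideal.span_base[OF f(1)] S f forms by (metis form_iff)
    moreover have "\<not> j < d"
      using form_in_span(2)[of S d v j] rideal.span_base[OF v(1)] S v forms by (metis form_iff)
    ultimately have d: "d = j" by simp
    obtain a E D where res: "minimal_graded_free_resolution ?L a E D"
        "\<forall>i. \<forall>j'\<in>set (a i). int j' - int i \<le> int j"
      using reg unfolding has_regularity_def d by blast
    have "minimal_growth (graded_part ?L j)"
      by (rule minimal_growth_of_resolution[OF res(1)]) (use res(2) form_in_span(2)[of ?V j] forms in \<open>auto simp: form_iff\<close>)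
    then show "minimal_growth ?V" unfolding part .
  next
    assume "minimal_growth ?V"
    then have "has_regularity ?L (int j)"
      using False forms by (rule has_regularity_of_minimal_growth)
    then show "linear_resolution ?L" unfolding linear_resolution_def using forms by blast
  qed
qed

lemma componentwise_linear_iff:
  "rideal.subspace I \<Longrightarrow>
    componentwise_linear I \<longleftrightarrow> (\<forall>n. minimal_growth (graded_part I n))"
  using linear_resolution_span_graded_part_iff
  unfolding componentwise_linear_def deg_component_def graded_part_def by blast

theorem theorem1p2:
  fixes I J :: "'k::field poly poly set"
  assumes "infinite (UNIV :: 'k set)"
    and "homogeneous_ideal I" and "I \<noteq> {0}" and "componentwise_linear I"
    and "homogeneous_ideal J" and "J \<noteq> {0}" and "componentwise_linear J"
  shows "componentwise_linear (I + J) \<longleftrightarrow>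
    init_deg (I \<inter> J) = max (init_deg I) (init_deg J) \<or>
    (init_deg (I \<inter> J) = max (init_deg I) (init_deg J) + 1 \<and>
     ideal_colon (I + J) max_ideal \<noteq> ideal_colon I max_ideal + ideal_colon J max_ideal)"
proof -
  have I: "graded_ideal I" and J: "graded_ideal J"
    using assms by (simp_all add: graded_ideal_homogeneous)
  then have "componentwise_linear (I + J) \<longleftrightarrow> (\<forall>n. minimal_growth (graded_part (I + J) n))"
    by (intro componentwise_linear_iff ideal_plus graded_idealD(1))
  also have "\<dots> \<longleftrightarrow> init_deg (I \<inter> J) = max (init_deg I) (init_deg J) \<or>
    (init_deg (I \<inter> J) = max (init_deg I) (init_deg J) + 1 \<and>
     ideal_colon (I + J) max_ideal \<noteq> ideal_colon I max_ideal + ideal_colon J max_ideal)"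
    using I J assms componentwise_linear_iff graded_idealD(1)
    by (intro minimal_growth_sum_iff) blast+
  finally show ?thesis .
qed

end
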